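(* Let $a<b$ and let $F:\mathbb{R}^3\times[a,b]\to\mathbb{R}$ be continuous and satisfy (F1), (F2) and (F3) (as stated in the context). Then the eigenvalue problem $$F(u'',u',u,t)=-\mu u\ \text{ in } (a,b),\qquad u(a)=u(b)=0$$ has two sequences of solutions $\{(\lambda_n^+,u_n^+)\}_{n\ge0}$ and $\{(\lambda_n^-,u_n^-)\}_{n\ge0}$ (that is, $\mu=\lambda_n^\pm$, $u=u_n^\pm$) such that $u_n^+$ and $u_n^-$ both have $n$ interior zeros $t_1<\dots<t_n$ in $(a,b)$ (depending on $n$ and on the sign $\pm$), and $u_n^+$ (resp. $u_n^-$) is positive (resp. negative) in the interval $(a,t_1)$ and negative (resp. positive) on $(t_1,t_2)$, with the convention $t_{n+1}=b$ (the condition on $(t_1,t_2)$ being required only for $n\ge1$). Moreover, the sequences $\{\lambda^+_n\}$ and $\{\lambda_n^-\}$ are increasing, and the sequences $\{(\lambda_n^\pm,u_n^\pm)\}$ are complete in the sense that there are no eigenpairs of the problem outside these sequences (eigenfunctions being considered up to multiplication by positive constants).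
   Context: For $x\in\mathbb{R}$, $x^+=\max\{x,0\}$ and $x^-=\max\{-x,0\}$. $C_2(a,b)$ denotes $C^2(a,b)\cap C^1([a,b])$; a solution is a function $u\in C_2(a,b)$ satisfying the equation in $(a,b)$ and the boundary conditions; an eigenpair is $(\mu,u)$ with $\mu\in\mathbb{R}$ and $u\not\equiv0$ a solution. (F1) $F(sm,sp,su,t)=sF(m,p,u,t)$ for all $s\ge0$ and all $(m,p,u,t)$. (F2) There are constants $\Lambda\ge\lambda>0$, $\gamma>0$, $\delta>0$ such that for all $(m,p,u,t),(m',p',u',t)\in\mathbb{R}^3\times[a,b]$: $$\lambda(m-m')^+-\Lambda(m-m')^--\gamma|p-p'|-\delta|u-u'|\le F(m,p,u,t)-F(m',p',u',t)\le \Lambda(m-m')^+-\lambda(m-m')^-+\gamma|p-p'|+\delta|u-u'|.$$ (F3) For all $(m,p,u,t),(m',p',u',t)$: $-F(m'-m,p'-p,u'-u,t)\le F(m,p,u,t)-F(m',p',u',t)\le F(m-m',p-p',u-u',t)$. *)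

theory Defs
  imports "HOL-Analysis.Analysis"
begin

definition pos_part :: "real \<Rightarrow> real" where
  "pos_part x = max x 0"

definition neg_part :: "real \<Rightarrow> real" where
  "neg_part x = max (- x) 0"

(* Operators F on R^3 x [a,b] are curried functions of m, p, u, t; their values
   for t outside [a,b] are irrelevant and never used. *)

definition continuous_operator ::
    "real \<Rightarrow> real \<Rightarrow> (real \<Rightarrow> real \<Rightarrow> real \<Rightarrow> real \<Rightarrow> real) \<Rightarrow> bool" where
  "continuous_operator a b F \<longleftrightarrow>
     continuous_on (UNIV \<times> UNIV \<times> UNIV \<times> {a..b}) (\<lambda>(m, p, u, t). F m p u t)"

definition F1 :: "real \<Rightarrow> real \<Rightarrow> (real \<Rightarrow> real \<Rightarrow> real \<Rightarrow> real \<Rightarrow> real) \<Rightarrow> bool" where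
  "F1 a b F \<longleftrightarrow>
     (\<forall>s\<ge>0. \<forall>m p u. \<forall>t\<in>{a..b}. F (s * m) (s * p) (s * u) t = s * F m p u t)"

definition F2 :: "real \<Rightarrow> real \<Rightarrow> (real \<Rightarrow> real \<Rightarrow> real \<Rightarrow> real \<Rightarrow> real) \<Rightarrow> bool" where
  "F2 a b F \<longleftrightarrow>
     (\<exists>\<Lambda> l \<gamma> \<delta>. \<Lambda> \<ge> l \<and> l > 0 \<and> \<gamma> > 0 \<and> \<delta> > 0 \<and>
        (\<forall>m p u m' p' u'. \<forall>t\<in>{a..b}.
           l * pos_part (m - m') - \<Lambda> * neg_part (m - m') - \<gamma> * \<bar>p - p'\<bar> - \<delta> * \<bar>u - u'\<bar>
             \<le> F m p u t - F m' p' u' t \<and>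
           F m p u t - F m' p' u' t
             \<le> \<Lambda> * pos_part (m - m') - l * neg_part (m - m') + \<gamma> * \<bar>p - p'\<bar> + \<delta> * \<bar>u - u'\<bar>))"

definition F3 :: "real \<Rightarrow> real \<Rightarrow> (real \<Rightarrow> real \<Rightarrow> real \<Rightarrow> real \<Rightarrow> real) \<Rightarrow> bool" where
  "F3 a b F \<longleftrightarrow>
     (\<forall>m p u m' p' u'. \<forall>t\<in>{a..b}.
        - F (m' - m) (p' - p) (u' - u) t \<le> F m p u t - F m' p' u' t \<and>
        F m p u t - F m' p' u' t \<le> F (m - m') (p - p') (u - u') t)"

(* C^1([a,b]): derivatives at the endpoints are one-sided.  (The library's
   C1_differentiable_on uses two-sided derivatives and so would constrain u
   outside [a,b].) *)
definition C1_closed :: "real \<Rightarrow> real \<Rightarrow> (real \<Rightarrow> real) \<Rightarrow> bool" where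
  "C1_closed a b u \<longleftrightarrow>
     (\<exists>u'. (\<forall>t\<in>{a..b}. (u has_real_derivative u' t) (at t within {a..b})) \<and>
           continuous_on {a..b} u')"

definition C2_open :: "real \<Rightarrow> real \<Rightarrow> (real \<Rightarrow> real) \<Rightarrow> bool" where
  "C2_open a b u \<longleftrightarrow>
     u differentiable_on {a<..<b} \<and> deriv u differentiable_on {a<..<b} \<and>
     continuous_on {a<..<b} (deriv (deriv u))"

definition is_solution ::
    "real \<Rightarrow> real \<Rightarrow> (real \<Rightarrow> real \<Rightarrow> real \<Rightarrow> real \<Rightarrow> real) \<Rightarrow> real \<Rightarrow> (real \<Rightarrow> real) \<Rightarrow> bool" where
  "is_solution a b F \<mu> u \<longleftrightarrow>
     C2_open a b u \<and> C1_closed a b u \<and>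
     (\<forall>t\<in>{a<..<b}. F (deriv (deriv u) t) (deriv u t) (u t) t = - \<mu> * u t) \<and>
     u a = 0 \<and> u b = 0"

definition is_eigenpair ::
    "real \<Rightarrow> real \<Rightarrow> (real \<Rightarrow> real \<Rightarrow> real \<Rightarrow> real \<Rightarrow> real) \<Rightarrow> real \<Rightarrow> (real \<Rightarrow> real) \<Rightarrow> bool" where
  "is_eigenpair a b F \<mu> u \<longleftrightarrow> is_solution a b F \<mu> u \<and> (\<exists>t\<in>{a..b}. u t \<noteq> 0)"

(* u has exactly n zeros z 1 < ... < z n in (a,b), is positive on (a, z 1) and,
   if n >= 1, negative on (z 1, z 2), where z (n + 1) = b.  The opposite sign
   pattern for u is this property for -u. *)
definition nodal :: "real \<Rightarrow> real \<Rightarrow> nat \<Rightarrow> (real \<Rightarrow> real) \<Rightarrow> bool" where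
  "nodal a b n u \<longleftrightarrow>
     (\<exists>z :: nat \<Rightarrow> real.
        strict_mono_on {1..n} z \<and> {t \<in> {a<..<b}. u t = 0} = z ` {1..n} \<and> z (n + 1) = b \<and>
        (\<forall>t\<in>{a<..<z 1}. u t > 0) \<and>
        (n \<ge> 1 \<longrightarrow> (\<forall>t\<in>{z 1<..<z 2}. u t < 0)))"

end

theory Submission
  imports Defs
begin

text \<open>Uniform ellipticity allows solving \<open>F(u'', u', u, t) = - \<mu> u\<close> for \<open>u''\<close>, with a right-hand side
  that is Lipschitz and positively homogeneous in \<open>(u', u)\<close>. In polar coordinates \<open>u = r sin \<theta>\<close>,
  \<open>u' = r cos \<theta>\<close>, the angle satisfies a scalar equation not involving \<open>r\<close>, whose right-hand side is
  increasing in \<open>\<mu>\<close> and equals 1 where \<open>sin \<theta> = 0\<close>. Hence \<open>\<theta>\<close> passes each multiple of \<open>\<pi>\<close> only once,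
  upwards, and \<open>\<theta>(b)\<close> is a continuous, strictly increasing function of \<open>\<mu>\<close>. With \<open>\<theta>(a) = j \<pi>\<close>, it
  stays below \<open>j \<pi> + \<pi>/2\<close> for very negative \<open>\<mu>\<close>, since that constant is then a supersolution, and it
  tends to infinity as \<open>\<mu>\<close> does, since the angle of \<open>(k u, u')\<close> then moves at speed at least \<open>k/2\<close>.
  The eigenvalues are the solutions of \<open>\<theta>(b) = (j + n + 1) \<pi>\<close>, where \<open>j = 0\<close> gives \<open>\<lambda>\<^sub>n\<^sup>+\<close> and \<open>j = 1\<close> gives
  \<open>\<lambda>\<^sub>n\<^sup>-\<close>; uniqueness for the initial value problem shows that there are no others.\<close>

section \<open>Scalar differential equations on a compact interval\<close>

text \<open>Beyond the last point before \<open>s\<close> with \<open>v \<le> 0\<close>,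
  \<open>v\<close> is positive and hence nonincreasing, so it cannot climb. Asking for the
  derivative bound only where \<open>v > 0\<close> lets later arguments use a Lipschitz estimate on
  one side.\<close>

lemma nonpos_if_deriv_nonpos_where_pos:
  fixes v v' :: "real \<Rightarrow> real"
  assumes cont: "continuous_on {a..b} v"
    and der: "\<And>t. t \<in> {a<..<b} \<Longrightarrow> (v has_real_derivative v' t) (at t)"
    and init: "v a \<le> 0"
    and le: "\<And>t. t \<in> {a<..<b} \<Longrightarrow> v t > 0 \<Longrightarrow> v' t \<le> 0"
    and s: "s \<in> {a..b}"
  shows "v s \<le> 0"
proof (rule ccontr)
  assume "\<not> v s \<le> 0"
  then have pos: "v s > 0" by simp
  define S where "S = {t \<in> {a..s}. v t \<le> 0}"
  have contS: "continuous_on {a..s} v"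
    using cont s by (auto intro: continuous_on_subset)
  have "closed S" unfolding S_def
    by (rule continuous_on_closed_Collect_le[OF contS continuous_on_const]) simp
  moreover have "S \<noteq> {}" "bdd_above S"
    using s init by (auto simp: S_def intro!: bdd_aboveI[of _ s])
  ultimately have t0: "Sup S \<in> S"
    by (intro closed_contains_Sup)
  define t0 where "t0 = Sup S"
  have "t0 < s" "a \<le> t0" "v t0 \<le> 0"
    using t0 pos unfolding t0_def[symmetric] by (auto simp: S_def order_le_less)
  have gt: "v x > 0" if "t0 < x" "x < s" for x
  proof (rule ccontr)
    assume "\<not> v x > 0"
    then have "x \<in> S" using that \<open>a \<le> t0\<close> by (auto simp: S_def)
    then have "x \<le> t0" unfolding t0_def by (intro cSup_upper) (use \<open>bdd_above S\<close> in auto)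
    then show False using that by simp
  qed
  have "v t0 \<ge> v s"
  proof (rule DERIV_nonpos_imp_decreasing_open[of t0 s v])
    show "\<exists>y. DERIV v x :> y \<and> y \<le> 0" if "t0 < x" "x < s" for x
      using that der[of x] le[of x] gt[of x] \<open>a \<le> t0\<close> s by auto
    show "continuous_on {t0..s} v"
      using contS \<open>a \<le> t0\<close> by (auto intro: continuous_on_subset)
  qed (use \<open>t0 < s\<close> in simp)
  with \<open>v t0 \<le> 0\<close> pos show False by simp
qed

text \<open>The factor \<open>exp (- L * (t - a))\<close> absorbs the linear term and subtracting
  \<open>c * (t - a)\<close> the constant one; the subtracted term is nonnegative, so the new
  function is positive only where \<open>w\<close> is.\<close>

lemma gronwall_where_pos:
  fixes w w' :: "real \<Rightarrow> real"
  assumes cont: "continuous_on {a..b} w"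
    and der: "\<And>t. t \<in> {a<..<b} \<Longrightarrow> (w has_real_derivative w' t) (at t)"
    and init: "w a \<le> 0"
    and le: "\<And>t. t \<in> {a<..<b} \<Longrightarrow> w t > 0 \<Longrightarrow> w' t \<le> L * w t + c"
    and "L \<ge> 0" "c \<ge> 0"
    and s: "s \<in> {a..b}"
  shows "w s \<le> c * (s - a) * exp (L * (s - a))"
proof -
  define v where "v t = w t * exp (- L * (t - a)) - c * (t - a)" for t
  define v' where "v' t = (w' t - L * w t) * exp (- L * (t - a)) - c" for t
  have "v s \<le> 0"
  proof (rule nonpos_if_deriv_nonpos_where_pos[of a b v v'])
    show "continuous_on {a..b} v"
      unfolding v_def by (intro continuous_intros cont)
    show "(v has_real_derivative v' t) (at t)" if "t \<in> {a<..<b}" for t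
      unfolding v_def v'_def by (auto intro!: derivative_eq_intros der[OF that] simp: algebra_simps)
    show "v a \<le> 0" using init by (simp add: v_def)
    fix t assume t: "t \<in> {a<..<b}" and "v t > 0"
    then have "w t * exp (- L * (t - a)) > c * (t - a)" by (simp add: v_def)
    moreover have "c * (t - a) \<ge> 0" using t \<open>c \<ge> 0\<close> by simp
    ultimately have "w t * exp (- L * (t - a)) > 0" by linarith
    then have "w t > 0" by (simp add: zero_less_mult_iff)
    then have "w' t - L * w t \<le> c" using le[OF t] by simp
    then have "(w' t - L * w t) * exp (- L * (t - a)) \<le> c * exp (- L * (t - a))"
      by (rule mult_right_mono) simp
    also have "\<dots> \<le> c * 1"
      using t \<open>c \<ge> 0\<close> \<open>L \<ge> 0\<close> by (intro mult_left_mono) auto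
    finally show "v' t \<le> 0" by (simp add: v'_def)
  qed (use s in simp)
  then have "w s * exp (- L * (s - a)) * exp (L * (s - a)) \<le> c * (s - a) * exp (L * (s - a))"
    by (intro mult_right_mono) (auto simp: v_def)
  then show ?thesis by (simp add: mult.assoc flip: exp_add)
qed

text \<open>The Picard operator is conjugated with the weight \<open>exp (- K t)\<close>, which makes it a
  contraction on the whole interval at once.\<close>

lemma picard_lindelof_global:
  fixes f :: "real \<Rightarrow> real \<Rightarrow> real"
  assumes "a \<le> b"
    and cont: "continuous_on (UNIV \<times> {a..b}) (\<lambda>(x, t). f x t)"
    and lip: "\<And>x y t. t \<in> {a..b} \<Longrightarrow> \<bar>f x t - f y t\<bar> \<le> L * \<bar>x - y\<bar>"
  shows "\<exists>\<theta>. \<theta> a = x0 \<and>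
           (\<forall>t\<in>{a..b}. (\<theta> has_real_derivative f (\<theta> t) t) (at t within {a..b}))"
proof -
  have "0 \<le> \<bar>f 1 a - f 0 a\<bar>" by simp
  also have "\<dots> \<le> L" using lip[of a 1 0] \<open>a \<le> b\<close> by simp
  finally have "L \<ge> 0" .
  \<comment> \<open>Any \<open>K > L\<close> would do: the contraction factor below is
    \<open>L / K\<close>.\<close>
  define K where "K = L + 1"
  have "K > 0" using \<open>L \<ge> 0\<close> by (simp add: K_def)
  \<comment> \<open>Bounded continuous functions live on the whole line, so arguments are projected
    to \<open>{a..b}\<close>; compactness then bounds the image.\<close>
  define clip where "clip t = max a (min b t)" for t
  have clip: "clip t \<in> {a..b}" for t using \<open>a \<le> b\<close> by (auto simp: clip_def)
  have cont_clip: "continuous_on S clip" for S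
    unfolding clip_def by (intro continuous_intros)
  have clip_id: "clip t = t" if "t \<in> {a..b}" for t using that by (auto simp: clip_def)
  \<comment> \<open>\<open>v\<close> stands for \<open>exp (- K * \<tau>) * \<theta> \<tau>\<close>,
    so the weight is undone before \<open>f\<close> is applied.\<close>
  define h where "h v \<tau> = f (exp (K * \<tau>) * apply_bcontfun v \<tau>) \<tau>" for v \<tau>
  have cont_h: "continuous_on {a..b} (h v)" for v
  proof -
    have "continuous_on {a..b} (\<lambda>\<tau>. (exp (K * \<tau>) * apply_bcontfun v \<tau>, \<tau>))"
      by (intro continuous_intros) simp
    from continuous_on_compose2[OF cont this] show ?thesis
      unfolding h_def by (auto simp: case_prod_unfold)
  qed
  define I where "I v s = integral {a..s} (h v)" for v s
  have I_deriv: "(I v has_real_derivative h v t) (at t within {a..b})" if "t \<in> {a..b}" for v t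
    unfolding I_def by (rule integral_has_real_derivative[OF cont_h that])
  have cont_I: "continuous_on {a..b} (I v)" for v
    using I_deriv by (rule DERIV_continuous_on)
  define T where "T v t = exp (- K * clip t) * (x0 + I v (clip t))" for v t
  have T: "T v \<in> bcontfun" for v
  proof -
    have c: "continuous_on {a..b} (\<lambda>s. exp (- K * s) * (x0 + I v s))"
      by (intro continuous_intros cont_I)
    have "continuous_on UNIV (T v)"
      unfolding T_def
      by (rule continuous_on_compose2[OF c cont_clip]) (use clip in auto)
    moreover have "range (T v) \<subseteq> (\<lambda>s. exp (- K * s) * (x0 + I v s)) ` {a..b}"
      using clip by (auto simp: T_def)
    then have "bounded (range (T v))"
      using compact_imp_bounded[OF compact_continuous_image[OF c compact_Icc]] bounded_subset by blast
    ultimately show ?thesis by (simp add: bcontfun_def)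
  qed
  define TT where "TT v = Bcontfun (T v)" for v
  have TT: "apply_bcontfun (TT v) = T v" for v
    unfolding TT_def using T by (rule Bcontfun_inverse)
  \<comment> \<open>The bound is \<open>L * dist v w\<close> times an antiderivative of
    \<open>exp (K * s)\<close>, which is where the factor \<open>1 / K\<close> arises. Exchanging
    \<open>v\<close> and \<open>w\<close> gives the other sign.\<close>
  have half: "I v s - I w s \<le> L / K * dist v w * exp (K * s)" if s: "s \<in> {a..b}" for v w s
  proof -
    define d where "d t = I v t - I w t - L / K * dist v w * exp (K * t)" for t
    have "d s \<le> 0"
    proof (rule nonpos_if_deriv_nonpos_where_pos[of a b d
            "\<lambda>t. h v t - h w t - L / K * dist v w * (K * exp (K * t))"])
      show "continuous_on {a..b} d"
        unfolding d_def by (intro continuous_intros cont_I)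
      show "(d has_real_derivative h v t - h w t - L / K * dist v w * (K * exp (K * t))) (at t)"
        if t: "t \<in> {a<..<b}" for t
      proof -
        have I: "(I u has_real_derivative h u t) (at t)" for u
          using I_deriv[of t u] t at_within_Icc_at[of a t b] by auto
        show ?thesis unfolding d_def
          by (auto intro!: derivative_eq_intros I simp: algebra_simps)
      qed
      show "d a \<le> 0" using \<open>L \<ge> 0\<close> \<open>K > 0\<close> by (simp add: d_def I_def)
      fix t assume t: "t \<in> {a<..<b}"
      have "h v t - h w t \<le> L * \<bar>exp (K * t) * apply_bcontfun v t - exp (K * t) * apply_bcontfun w t\<bar>"
        unfolding h_def using lip[of t] t by (meson abs_ge_self greaterThanLessThan_subseteq_atLeastAtMost_iff order.trans order_refl subsetD)
      also have "\<dots> = L * exp (K * t) * dist (apply_bcontfun v t) (apply_bcontfun w t)"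
        by (simp add: dist_real_def abs_mult flip: right_diff_distrib)
      also have "\<dots> \<le> L * exp (K * t) * dist v w"
        using \<open>L \<ge> 0\<close> by (intro mult_left_mono dist_bounded) auto
      finally show "h v t - h w t - L / K * dist v w * (K * exp (K * t)) \<le> 0"
        using \<open>K > 0\<close> by (simp add: field_simps)
    qed (use s in simp)
    then show ?thesis by (simp add: d_def)
  qed
  have "\<forall>v w. dist (TT v) (TT w) \<le> L / K * dist v w"
  proof (intro allI dist_bound)
    fix v w :: "real \<Rightarrow>\<^sub>C real" and t :: real
    let ?s = "clip t"
    have "dist (apply_bcontfun (TT v) t) (apply_bcontfun (TT w) t)
        = exp (- K * ?s) * \<bar>I v ?s - I w ?s\<bar>"
      by (simp add: TT T_def dist_real_def abs_mult flip: right_diff_distrib)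
    also have "\<dots> \<le> exp (- K * ?s) * (L / K * dist v w * exp (K * ?s))"
      using half[of ?s v w] half[of ?s w v] clip[of t]
      by (intro mult_left_mono) (auto simp: dist_commute abs_le_iff)
    also have "\<dots> = L / K * dist v w"
      by (simp add: exp_minus)
    finally show "dist (apply_bcontfun (TT v) t) (apply_bcontfun (TT w) t) \<le> L / K * dist v w" .
  qed
  then obtain v where v: "TT v = v"
    using banach_fix_type[of "L / K" TT] \<open>L \<ge> 0\<close> \<open>K > 0\<close> by (auto simp: K_def)
  define \<theta> where "\<theta> t = x0 + I v t" for t
  have eq: "exp (K * t) * apply_bcontfun v t = \<theta> t" if "t \<in> {a..b}" for t
  proof -
    have "apply_bcontfun v t = exp (- K * t) * \<theta> t"
      using fun_cong[OF TT, of v t] clip_id[OF that] v by (simp add: T_def \<theta>_def)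
    then show ?thesis by (simp add: exp_minus)
  qed
  have "(\<theta> has_real_derivative f (\<theta> t) t) (at t within {a..b})" if "t \<in> {a..b}" for t
    using I_deriv[OF that, of v] eq[OF that]
    by (auto simp: \<theta>_def[abs_def] h_def intro!: derivative_eq_intros)
  moreover have "\<theta> a = x0" by (simp add: \<theta>_def I_def)
  ultimately show ?thesis by blast
qed

text \<open>Where the subsolution \<open>\<theta>\<close> exceeds \<open>\<psi>\<close>, a
  supersolution up to the defect \<open>c\<close>, the difference grows at rate at most
  \<open>L * (\<theta> t - \<psi> t) + c\<close>, and Gronwall applies. \<open>c = 0\<close> gives
  comparison, \<open>c > 0\<close> continuous dependence on the parameter.\<close>

lemma ode_comparison:
  fixes f :: "real \<Rightarrow> real \<Rightarrow> real"
  assumes lip: "\<And>x y t. t \<in> {a..b} \<Longrightarrow> \<bar>f x t - f y t\<bar> \<le> L * \<bar>x - y\<bar>"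
    and der1: "\<And>t. t \<in> {a..b} \<Longrightarrow> (\<theta> has_real_derivative \<theta>' t) (at t within {a..b})"
    and der2: "\<And>t. t \<in> {a..b} \<Longrightarrow> (\<psi> has_real_derivative \<psi>' t) (at t within {a..b})"
    and sub: "\<And>t. t \<in> {a..b} \<Longrightarrow> \<theta>' t \<le> f (\<theta> t) t"
    and super: "\<And>t. t \<in> {a..b} \<Longrightarrow> f (\<psi> t) t \<le> \<psi>' t + c"
    and init: "\<theta> a \<le> \<psi> a"
    and "c \<ge> 0" and s: "s \<in> {a..b}"
  shows "\<theta> s - \<psi> s \<le> c * (s - a) * exp (L * (s - a))"
proof (rule gronwall_where_pos[of a b "\<lambda>t. \<theta> t - \<psi> t" "\<lambda>t. \<theta>' t - \<psi>' t"])
  show "continuous_on {a..b} (\<lambda>t. \<theta> t - \<psi> t)"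
    using DERIV_continuous_on[OF der1] DERIV_continuous_on[OF der2] by (intro continuous_intros)
  show "((\<lambda>t. \<theta> t - \<psi> t) has_real_derivative \<theta>' t - \<psi>' t) (at t)" if "t \<in> {a<..<b}" for t
    using der1[of t] der2[of t] that at_within_Icc_at[of a t b] by (auto intro!: DERIV_diff)
  show "\<theta> a - \<psi> a \<le> 0" using init by simp
  show "\<theta>' t - \<psi>' t \<le> L * (\<theta> t - \<psi> t) + c" if "t \<in> {a<..<b}" "\<theta> t - \<psi> t > 0" for t
    using sub[of t] super[of t] lip[of t "\<theta> t" "\<psi> t"] that by auto
  have "0 \<le> \<bar>f 1 s - f 0 s\<bar>" by simp
  then show "L \<ge> 0" using lip[OF s, of 1 0] by simp
qed (use assms in auto)

section \<open>Plane polar angles\<close>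
text \<open>For \<open>k > 0\<close>, the angle \<open>\<alpha>\<close> with \<open>tan \<alpha> = k * tan x\<close>, continuous in \<open>x\<close> and equal to \<open>x\<close>
  at the multiples of \<open>\<pi>\<close>.\<close>

definition scaled_angle :: "real \<Rightarrow> real \<Rightarrow> real" where
  "scaled_angle k x = x + arctan ((k - 1) * (sin x * cos x) / ((cos x)\<^sup>2 + k * (sin x)\<^sup>2))"

lemma sin_cos_form_pos:
  fixes k x :: real
  assumes "k > 0"
  shows "(cos x)\<^sup>2 + k * (sin x)\<^sup>2 > 0"
proof (cases "sin x = 0")
  case True
  then show ?thesis using sin_cos_squared_add[of x] by simp
next
  case False
  then show ?thesis using assms by (simp add: add_nonneg_pos)
qed

text \<open>This is the derivative of \<open>arctan (k * tan x)\<close>, computed from a formula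
  without the poles of \<open>tan\<close>.\<close>

lemma scaled_angle_deriv:
  assumes "k > 0"
  shows "(scaled_angle k has_real_derivative k / ((cos x)\<^sup>2 + k\<^sup>2 * (sin x)\<^sup>2)) (at x)"
proof -
  \<comment> \<open>In \<open>P\<close> and \<open>Q = 1 - P\<close> the identities below become
    polynomial; the key one is \<open>D\<^sup>2 + N\<^sup>2 = Q + k\<^sup>2 * P\<close>.\<close>
  define P Q where "P = (sin x)\<^sup>2" and "Q = (cos x)\<^sup>2"
  have Q: "Q = 1 - P" by (simp add: P_def Q_def cos_squared_eq)
  define N D where "N = (k - 1) * (sin x * cos x)" and "D = Q + k * P"
  have "D > 0" using sin_cos_form_pos[OF assms, of x] by (simp add: D_def P_def Q_def)
  have N2: "N\<^sup>2 = (k - 1)\<^sup>2 * P * Q" by (simp add: N_def P_def Q_def power_mult_distrib)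
  have DN: "D\<^sup>2 + N\<^sup>2 = Q + k\<^sup>2 * P"
    unfolding N2 D_def Q by (simp add: power2_eq_square algebra_simps)
  have pos: "Q + k\<^sup>2 * P > 0" using sin_cos_form_pos[of "k\<^sup>2" x] assms by (simp add: P_def Q_def)
  define N' D' where "N' = (k - 1) * (Q - P)" and "D' = 2 * (k - 1) * (sin x * cos x)"
  have ND': "N * D' = 2 * (k - 1)\<^sup>2 * (P * Q)"
    by (simp add: N_def D'_def P_def Q_def power2_eq_square algebra_simps)
  have "((\<lambda>x. (k - 1) * (sin x * cos x)) has_real_derivative N') (at x)"
    by (auto intro!: derivative_eq_intros simp: N'_def P_def Q_def power2_eq_square algebra_simps)
  moreover have "((\<lambda>x. (cos x)\<^sup>2 + k * (sin x)\<^sup>2) has_real_derivative D') (at x)"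
    by (auto intro!: derivative_eq_intros simp: D'_def algebra_simps)
  ultimately have "((\<lambda>x. (k - 1) * (sin x * cos x) / ((cos x)\<^sup>2 + k * (sin x)\<^sup>2)) has_real_derivative
      (N' * D - N * D') / (D * D)) (at x)"
    using DERIV_divide \<open>D > 0\<close> unfolding N_def D_def P_def Q_def by fastforce
  from DERIV_add[OF DERIV_ident DERIV_chain2[OF DERIV_arctan this]]
  have "(scaled_angle k has_real_derivative
      1 + ((N' * D - N * D') / (D * D)) / (1 + (N / D)\<^sup>2)) (at x)"
    unfolding scaled_angle_def[abs_def] N_def D_def P_def Q_def
    by (simp add: divide_inverse mult.commute)
  moreover have "1 + (N / D)\<^sup>2 = (Q + k\<^sup>2 * P) / (D * D)"
    unfolding DN[symmetric] using \<open>D > 0\<close>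
    by (simp add: power_divide power2_eq_square add_divide_distrib)
  moreover have "N' * D - N * D' = k - (Q + k\<^sup>2 * P)"
    unfolding ND' N'_def D_def Q by (simp add: power2_eq_square algebra_simps)
  ultimately have "(scaled_angle k has_real_derivative
      1 + (k - (Q + k\<^sup>2 * P)) / (Q + k\<^sup>2 * P)) (at x)"
    using \<open>D > 0\<close> by simp
  then show ?thesis using pos by (simp add: P_def Q_def diff_divide_distrib)
qed

text \<open>The nodes are the times at which \<open>\<theta>\<close> meets a multiple of \<pi>: the
  intermediate value theorem supplies them, \<open>crosses\<close> makes each unique and orders
  them, and the sign of \<open>u\<close> in between is that of
  \<open>sin (\<theta> t)\<close>.\<close>

lemma nodal_if_polar:
  fixes \<theta> r u :: "real \<Rightarrow> real"
  assumes "a < b" and cont: "continuous_on {a..b} \<theta>"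
    and init: "\<theta> a = 0" and end_angle: "\<theta> b = real (n + 1) * pi"
    and crosses: "\<And>k s t. s \<in> {a..b} \<Longrightarrow> t \<in> {a..b} \<Longrightarrow> s < t \<Longrightarrow> real k * pi \<le> \<theta> s
      \<Longrightarrow> real k * pi < \<theta> t"
    and r: "\<And>t. t \<in> {a..b} \<Longrightarrow> r t > 0"
    and u: "\<And>t. t \<in> {a..b} \<Longrightarrow> u t = r t * sin (\<theta> t)"
  shows "nodal a b n u"
proof -
  have "\<forall>k\<in>{..n + 1}. \<exists>t. t \<in> {a..b} \<and> \<theta> t = real k * pi"
  proof
    fix k assume "k \<in> {..n + 1}"
    then have "\<theta> a \<le> real k * pi" "real k * pi \<le> \<theta> b"
      unfolding init end_angle by (auto intro: mult_right_mono)
    from IVT'[OF this _ cont] show "\<exists>t. t \<in> {a..b} \<and> \<theta> t = real k * pi"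
      using \<open>a < b\<close> by auto
  qed
  \<comment> \<open>Both ends are included, as \<open>z 0 = a\<close> and
    \<open>z (n + 1) = b\<close>, so the first and last nodal intervals need no separate
    treatment.\<close>
  then obtain z where z: "\<And>k. k \<le> n + 1 \<Longrightarrow> z k \<in> {a..b} \<and> \<theta> (z k) = real k * pi"
    by (auto dest!: bchoice)
  have above: "real k * pi < \<theta> t" if "k \<le> n + 1" "t \<in> {a..b}" "z k < t" for k t
    using crosses[of "z k" t k] z[of k] that by auto
  have below: "\<theta> t < real k * pi" if "k \<le> n + 1" "t \<in> {a..b}" "t < z k" for k t
    using crosses[of t "z k" k] z[of k] that by force
  have unique: "t = z k" if "k \<le> n + 1" "t \<in> {a..b}" "\<theta> t = real k * pi" for k t
    using above[of k t] below[of k t] that by (cases t "z k" rule: linorder_cases) auto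
  have z0: "z 0 = a" and zb: "z (n + 1) = b"
    using unique[of 0 a] unique[of "n + 1" b] init end_angle \<open>a < b\<close> by auto
  have mono: "z j < z k" if "j < k" "k \<le> n + 1" for j k
  proof (rule ccontr)
    assume "\<not> z j < z k"
    then have "real k * pi \<le> \<theta> (z j)"
      using above[of k "z j"] z[of j] z[of k] that by (cases "z j = z k") auto
    then show False using z[of j] that by simp
  qed
  have "{t \<in> {a<..<b}. u t = 0} = z ` {1..n}"
  proof (intro equalityI subsetI)
    fix t assume "t \<in> {t \<in> {a<..<b}. u t = 0}"
    then have t: "t \<in> {a<..<b}" "sin (\<theta> t) = 0" using u[of t] r[of t] by auto
    then obtain i :: int where i: "\<theta> t = of_int i * pi" by (auto simp: sin_zero_iff_int2)
    have "0 < of_int i * pi" "of_int i * pi < real (n + 1) * pi"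
      using above[of 0 t] below[of "n + 1" t] t z0 zb by (simp_all add: i)
    then have "0 < real_of_int i" "real_of_int i < real (n + 1)"
      by (simp_all add: zero_less_mult_iff mult_less_cancel_right)
    then have "nat i \<in> {1..n}" "real (nat i) = of_int i" by auto
    moreover from this have "t = z (nat i)" using unique[of "nat i" t] t i by auto
    ultimately show "t \<in> z ` {1..n}" by blast
  next
    fix t assume "t \<in> z ` {1..n}"
    then obtain k where k: "t = z k" "1 \<le> k" "k \<le> n" by auto
    then show "t \<in> {t \<in> {a<..<b}. u t = 0}"
      using mono[of 0 k] mono[of k "n + 1"] z0 zb z[of k] u[of t] by auto
  qed
  moreover have "strict_mono_on {1..n} z"
    by (intro strict_mono_onI mono) auto
  moreover have "\<forall>t\<in>{a<..<z 1}. u t > 0"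
  proof
    fix t assume t: "t \<in> {a<..<z 1}"
    then have t': "t \<in> {a..b}" using z[of 1] by auto
    then have "sin (\<theta> t) > 0"
      using above[of 0 t] below[of 1 t] t z0 by (intro sin_gt_zero) auto
    then show "u t > 0" using u[OF t'] r[OF t'] by simp
  qed
  moreover have "\<forall>t\<in>{z 1<..<z 2}. u t < 0" if "n \<ge> 1"
  proof
    fix t assume t: "t \<in> {z 1<..<z 2}"
    then have t': "t \<in> {a..b}" using z[of 1] z[of 2] that by auto
    then have "sin (\<theta> t) < 0"
      using above[of 1 t] below[of 2 t] t that by (intro sin_lt_zero) auto
    then show "u t < 0" using u[OF t'] r[OF t'] by (simp add: mult_pos_neg)
  qed
  ultimately show ?thesis unfolding nodal_def using zb by (intro exI[of _ z]) auto
qed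

section \<open>Solving for the leading derivative\<close>

locale uniformly_elliptic_operator =
  fixes a b :: real and F :: "real \<Rightarrow> real \<Rightarrow> real \<Rightarrow> real \<Rightarrow> real" and l \<Lambda> \<gamma> \<delta> :: real
  assumes less: "a < b"
    and cont: "continuous_operator a b F"
    and homogeneous: "F1 a b F"
    and constants: "0 < l" "l \<le> \<Lambda>" "0 < \<gamma>" "0 < \<delta>"
    and lower: "\<And>m p u m' p' u' t. t \<in> {a..b} \<Longrightarrow>
      l * pos_part (m - m') - \<Lambda> * neg_part (m - m') - \<gamma> * \<bar>p - p'\<bar> - \<delta> * \<bar>u - u'\<bar>
        \<le> F m p u t - F m' p' u' t"
    and upper: "\<And>m p u m' p' u' t. t \<in> {a..b} \<Longrightarrow>
      F m p u t - F m' p' u' t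
        \<le> \<Lambda> * pos_part (m - m') - l * neg_part (m - m') + \<gamma> * \<bar>p - p'\<bar> + \<delta> * \<bar>u - u'\<bar>"
begin

lemma Lambda_pos: "0 < \<Lambda>"
  using constants by simp

lemma F_increasing:
  assumes "t \<in> {a..b}" "m' \<le> m"
  shows "l * (m - m') \<le> F m p u t - F m' p u t" "F m p u t - F m' p u t \<le> \<Lambda> * (m - m')"
  using lower[OF assms(1), of m m' p p u u] upper[OF assms(1), of m p u m' p u] assms(2)
  by (auto simp: pos_part_def neg_part_def)

lemma F_expanding:
  assumes "t \<in> {a..b}"
  shows "l * \<bar>m - m'\<bar> \<le> \<bar>F m p u t - F m' p u t\<bar>"
  using F_increasing(1)[OF assms, of m m' p u] F_increasing(1)[OF assms, of m' m p u]
  by (cases "m \<le> m'") (auto simp: abs_if)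

lemma F_lipschitz_lower_order:
  assumes "t \<in> {a..b}"
  shows "\<bar>F m p u t - F m p' u' t\<bar> \<le> \<gamma> * \<bar>p - p'\<bar> + \<delta> * \<bar>u - u'\<bar>"
  using lower[OF assms, of m m p p' u u'] upper[OF assms, of m p u m p' u']
  by (simp add: pos_part_def neg_part_def abs_le_iff)

lemma F_zero: "t \<in> {a..b} \<Longrightarrow> F 0 0 0 t = 0"
  using homogeneous[unfolded F1_def, rule_format, of 0 t 0 0 0] by simp

lemma F_homogeneous: "s \<ge> 0 \<Longrightarrow> t \<in> {a..b} \<Longrightarrow> F (s * m) (s * p) (s * u) t = s * F m p u t"
  using homogeneous by (simp add: F1_def)

lemma continuous_on_F:
  assumes "continuous_on S m" "continuous_on S p" "continuous_on S u" "continuous_on S \<tau>"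
    and "\<tau> ` S \<subseteq> {a..b}"
  shows "continuous_on S (\<lambda>x. F (m x) (p x) (u x) (\<tau> x))"
proof -
  have "continuous_on S (\<lambda>x. (m x, p x, u x, \<tau> x))"
    by (intro continuous_intros assms)
  from continuous_on_compose2[OF cont[unfolded continuous_operator_def] this] show ?thesis
    using assms(5) by auto
qed

lemma F_bijective:
  assumes t: "t \<in> {a..b}"
  shows "\<exists>!m. F m p u t = q"
proof (rule ex_ex1I)
  \<comment> \<open>A slope of at least \<open>l\<close> over the length \<open>M\<close> covers the
    gap between \<open>F 0 p u t\<close> and \<open>q\<close>, so \<open>{- M..M}\<close> brackets a
    root.\<close>
  define M where "M = \<bar>q - F 0 p u t\<bar> / l"
  have "M \<ge> 0" "l * M = \<bar>q - F 0 p u t\<bar>" using constants by (auto simp: M_def)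
  then have "F (- M) p u t \<le> q" "q \<le> F M p u t"
    using F_increasing(1)[OF t, of 0 M p u] F_increasing(1)[OF t, of "- M" 0 p u] by auto
  moreover have "continuous_on {- M..M} (\<lambda>m. F m p u t)"
    using t by (intro continuous_on_F continuous_intros) auto
  ultimately show "\<exists>m. F m p u t = q"
    using IVT'[of "\<lambda>m. F m p u t" "- M" q M] \<open>M \<ge> 0\<close> by auto
  show "m = m'" if "F m p u t = q" "F m' p u t = q" for m m'
    using F_expanding[OF t, of m m' p u] that constants by (auto simp: mult_le_0_iff)
qed

text \<open>The equation solved for its leading derivative: \<open>u'' = curvature \<mu> u' u t\<close>.\<close>

definition curvature :: "real \<Rightarrow> real \<Rightarrow> real \<Rightarrow> real \<Rightarrow> real" where
  "curvature \<mu> p u t = (THE m. F m p u t = - \<mu> * u)"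

lemma F_curvature: "t \<in> {a..b} \<Longrightarrow> F (curvature \<mu> p u t) p u t = - \<mu> * u"
  unfolding curvature_def by (rule theI') (rule F_bijective)

lemma curvature_unique: "t \<in> {a..b} \<Longrightarrow> F m p u t = - \<mu> * u \<Longrightarrow> curvature \<mu> p u t = m"
  using F_bijective[of t p u "- \<mu> * u"] F_curvature[of t \<mu> p u] by auto

text \<open>An a posteriori estimate: \<open>F\<close> grows in its first argument at rate at least
  \<open>l\<close>, so the residual of a trial value \<open>m\<close> controls its distance to the
  root.\<close>

lemma curvature_dist:
  assumes "t \<in> {a..b}"
  shows "\<bar>curvature \<mu> p u t - m\<bar> \<le> \<bar>- \<mu> * u - F m p u t\<bar> / l"
  using F_expanding[OF assms, of "curvature \<mu> p u t" m p u] constants F_curvature[OF assms, of \<mu> p u]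
  by (simp add: field_simps)

lemma curvature_zero: "t \<in> {a..b} \<Longrightarrow> curvature \<mu> 0 0 t = 0"
  by (rule curvature_unique) (simp_all add: F_zero)

lemma curvature_homogeneous:
  assumes "t \<in> {a..b}" "s \<ge> 0"
  shows "curvature \<mu> (s * p) (s * u) t = s * curvature \<mu> p u t"
  using assms by (intro curvature_unique) (simp_all add: F_homogeneous F_curvature)

lemma curvature_lipschitz_lower_order:
  assumes t: "t \<in> {a..b}"
  shows "\<bar>curvature \<mu> p u t - curvature \<mu> p' u' t\<bar> \<le> (\<gamma> * \<bar>p - p'\<bar> + (\<delta> + \<bar>\<mu>\<bar>) * \<bar>u - u'\<bar>) / l"
proof -
  \<comment> \<open>The root at \<open>(p', u')\<close> serves as trial value at
    \<open>(p, u)\<close>.\<close>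
  define m where "m = curvature \<mu> p' u' t"
  have "\<bar>- \<mu> * u - F m p u t\<bar> = \<bar>- (\<mu> * (u - u')) - (F m p u t - F m p' u' t)\<bar>"
    using F_curvature[OF t, of \<mu> p' u'] by (simp add: m_def algebra_simps)
  also have "\<dots> \<le> \<bar>\<mu>\<bar> * \<bar>u - u'\<bar> + \<bar>F m p u t - F m p' u' t\<bar>"
    by (simp flip: abs_mult)
  also have "\<dots> \<le> \<gamma> * \<bar>p - p'\<bar> + (\<delta> + \<bar>\<mu>\<bar>) * \<bar>u - u'\<bar>"
    using F_lipschitz_lower_order[OF t, of m p u p' u'] by (simp add: algebra_simps)
  finally have "\<bar>- \<mu> * u - F m p u t\<bar> / l \<le> (\<gamma> * \<bar>p - p'\<bar> + (\<delta> + \<bar>\<mu>\<bar>) * \<bar>u - u'\<bar>) / l"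
    using constants by (intro divide_right_mono) auto
  with curvature_dist[OF t, of \<mu> p u m] show ?thesis by (simp add: m_def)
qed

definition lipschitz_const :: "real \<Rightarrow> real" where
  "lipschitz_const \<mu> = (\<gamma> + \<delta> + \<bar>\<mu>\<bar>) / l"

lemma lipschitz_const_pos: "lipschitz_const \<mu> > 0"
  using constants by (simp add: lipschitz_const_def add_pos_nonneg)

lemma curvature_lipschitz:
  assumes "t \<in> {a..b}"
  shows "\<bar>curvature \<mu> p u t - curvature \<mu> p' u' t\<bar> \<le> lipschitz_const \<mu> * (\<bar>p - p'\<bar> + \<bar>u - u'\<bar>)"
proof -
  have "\<gamma> * \<bar>p - p'\<bar> \<le> (\<gamma> + \<delta> + \<bar>\<mu>\<bar>) * \<bar>p - p'\<bar>"
       "(\<delta> + \<bar>\<mu>\<bar>) * \<bar>u - u'\<bar> \<le> (\<gamma> + \<delta> + \<bar>\<mu>\<bar>) * \<bar>u - u'\<bar>"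
    using constants by (auto intro!: mult_right_mono)
  then have "\<gamma> * \<bar>p - p'\<bar> + (\<delta> + \<bar>\<mu>\<bar>) * \<bar>u - u'\<bar> \<le> (\<gamma> + \<delta> + \<bar>\<mu>\<bar>) * (\<bar>p - p'\<bar> + \<bar>u - u'\<bar>)"
    by (simp add: distrib_left)
  then have "(\<gamma> * \<bar>p - p'\<bar> + (\<delta> + \<bar>\<mu>\<bar>) * \<bar>u - u'\<bar>) / l \<le> lipschitz_const \<mu> * (\<bar>p - p'\<bar> + \<bar>u - u'\<bar>)"
    using constants by (simp add: lipschitz_const_def divide_right_mono)
  with curvature_lipschitz_lower_order[OF assms, of \<mu> p u p' u'] show ?thesis by simp
qed

text \<open>The root at the given point is kept as a fixed trial value at nearby points; its
  residual is continuous and vanishes at the given point.\<close>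

lemma continuous_on_curvature_Times:
  "continuous_on (UNIV \<times> UNIV \<times> {a..b}) (\<lambda>(p, u, t). curvature \<mu> p u t)"
  unfolding continuous_on_def
proof
  fix x :: "real \<times> real \<times> real" assume x: "x \<in> UNIV \<times> UNIV \<times> {a..b}"
  obtain p u t where [simp]: "x = (p, u, t)" by (cases x)
  define m where "m = curvature \<mu> p u t"
  let ?S = "UNIV \<times> UNIV \<times> {a..b}"
  let ?e = "\<lambda>(p, u, t). \<bar>- \<mu> * u - F m p u t\<bar> / l"
  have "continuous_on ?S ?e"
    unfolding case_prod_unfold
    using constants by (intro continuous_intros continuous_on_F) auto
  then have "(?e \<longlongrightarrow> ?e x) (at x within ?S)"
    using x by (auto simp: continuous_on_def)
  moreover have "?e x = 0" using x F_curvature[of t \<mu> p u] by (simp add: m_def)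
  ultimately have "(?e \<longlongrightarrow> 0) (at x within ?S)" by metis
  moreover have "\<forall>\<^sub>F y in at x within ?S. norm ((\<lambda>(p, u, t). curvature \<mu> p u t) y - m) \<le> ?e y"
    unfolding eventually_at_filter using curvature_dist by (intro always_eventually) auto
  ultimately have "((\<lambda>y. (\<lambda>(p, u, t). curvature \<mu> p u t) y - m) \<longlongrightarrow> 0) (at x within ?S)"
    by (rule Lim_null_comparison[rotated])
  then show "((\<lambda>(p, u, t). curvature \<mu> p u t) \<longlongrightarrow> (\<lambda>(p, u, t). curvature \<mu> p u t) x) (at x within ?S)"
    using Lim_null[of "\<lambda>(p, u, t). curvature \<mu> p u t" m "at x within ?S"] by (simp add: m_def)
qed

lemma continuous_on_curvature:
  assumes "continuous_on S p" "continuous_on S u" "continuous_on S \<tau>" and "\<tau> ` S \<subseteq> {a..b}"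
  shows "continuous_on S (\<lambda>x. curvature \<mu> (p x) (u x) (\<tau> x))"
proof -
  have "continuous_on S (\<lambda>x. (p x, u x, \<tau> x))"
    by (intro continuous_intros assms)
  from continuous_on_compose2[OF continuous_on_curvature_Times this] show ?thesis
    using assms(4) by auto
qed

text \<open>Subtracting the equations for the two roots leaves \<open>(\<nu> - \<mu>) * u\<close>,
  which ellipticity compares with the difference of the roots. The extra factor \<open>u\<close>
  gives both signs of \<open>u\<close> the same form.\<close>

lemma curvature_parameter:
  assumes t: "t \<in> {a..b}" and "\<mu> \<le> \<nu>"
  shows "(\<nu> - \<mu>) * u\<^sup>2 \<le> \<Lambda> * (u * (curvature \<mu> p u t - curvature \<nu> p u t))"
    and "l * (u * (curvature \<mu> p u t - curvature \<nu> p u t)) \<le> (\<nu> - \<mu>) * u\<^sup>2"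
proof -
  define m n where "m = curvature \<mu> p u t" and "n = curvature \<nu> p u t"
  have diff: "F m p u t - F n p u t = (\<nu> - \<mu>) * u"
    using F_curvature[OF t] by (simp add: m_def n_def algebra_simps)
  have "(\<nu> - \<mu>) * u\<^sup>2 \<le> \<Lambda> * (u * (m - n)) \<and> l * (u * (m - n)) \<le> (\<nu> - \<mu>) * u\<^sup>2"
  proof (cases "u \<ge> 0")
    case True
    have "n \<le> m"
    proof (rule ccontr)
      assume "\<not> n \<le> m"
      then have "0 < l * (n - m)" using constants by simp
      also have "\<dots> \<le> - ((\<nu> - \<mu>) * u)"
        using F_increasing(1)[OF t, of m n p u] \<open>\<not> n \<le> m\<close> diff by simp
      finally show False using True \<open>\<mu> \<le> \<nu>\<close> by (simp add: mult_less_0_iff)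
    qed
    from F_increasing[OF t this, of p u] diff True show ?thesis
      using mult_left_mono[of "l * (m - n)" "(\<nu> - \<mu>) * u" u]
        mult_left_mono[of "(\<nu> - \<mu>) * u" "\<Lambda> * (m - n)" u]
      by (simp add: power2_eq_square algebra_simps)
  next
    case False
    have "m \<le> n"
    proof (rule ccontr)
      assume "\<not> m \<le> n"
      then have "0 < l * (m - n)" using constants by simp
      also have "\<dots> \<le> (\<nu> - \<mu>) * u"
        using F_increasing(1)[OF t, of n m p u] \<open>\<not> m \<le> n\<close> diff by simp
      finally show False using False \<open>\<mu> \<le> \<nu>\<close> by (simp add: zero_less_mult_iff)
    qed
    from F_increasing[OF t this, of p u] diff False show ?thesis
      using mult_left_mono[of "l * (n - m)" "- ((\<nu> - \<mu>) * u)" "- u"]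
        mult_left_mono[of "- ((\<nu> - \<mu>) * u)" "\<Lambda> * (n - m)" "- u"]
      by (simp add: power2_eq_square algebra_simps)
  qed
  then show "(\<nu> - \<mu>) * u\<^sup>2 \<le> \<Lambda> * (u * (curvature \<mu> p u t - curvature \<nu> p u t))"
    and "l * (u * (curvature \<mu> p u t - curvature \<nu> p u t)) \<le> (\<nu> - \<mu>) * u\<^sup>2"
    by (auto simp: m_def n_def)
qed

section \<open>The Pruefer angle\<close>

text \<open>The right-hand side of the equation for \<open>\<theta>\<close> when \<open>u = r sin \<theta>\<close>, \<open>u' = r cos \<theta>\<close>;
  homogeneity makes it independent of \<open>r\<close>.\<close>

definition angular_speed :: "real \<Rightarrow> real \<Rightarrow> real \<Rightarrow> real" where
  "angular_speed \<mu> x t = (cos x)\<^sup>2 - sin x * curvature \<mu> (cos x) (sin x) t"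

lemma angular_speed_continuous:
  "continuous_on (UNIV \<times> {a..b}) (\<lambda>(x, t). angular_speed \<mu> x t)"
  unfolding angular_speed_def case_prod_unfold
  by (intro continuous_intros continuous_on_curvature) auto

lemma angular_speed_sin_zero: "sin x = 0 \<Longrightarrow> angular_speed \<mu> x t = 1"
  using sin_cos_squared_add[of x] by (simp add: angular_speed_def)

text \<open>The difference splits into three products. The squared cosine contributes 2; the change
  of the curvature and the change of its factor \<open>sin x\<close> contribute \<open>2 * K\<close>
  each, as the curvature vanishes at the origin and so is at most \<open>2 * K\<close> on the unit
  circle.\<close>

lemma angular_speed_lipschitz:
  assumes t: "t \<in> {a..b}"
  shows "\<bar>angular_speed \<mu> x t - angular_speed \<mu> y t\<bar> \<le> (2 + 4 * lipschitz_const \<mu>) * \<bar>x - y\<bar>"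
proof -
  define K where "K = lipschitz_const \<mu>"
  have "K > 0" by (simp add: K_def lipschitz_const_pos)
  have s: "\<bar>sin x - sin y\<bar> \<le> \<bar>x - y\<bar>" for x y :: real
  proof -
    have "\<bar>sin x - sin y\<bar> = 2 * (\<bar>sin ((x - y) / 2)\<bar> * \<bar>cos ((x + y) / 2)\<bar>)"
      by (simp add: sin_diff_sin abs_mult)
    also have "\<dots> \<le> 2 * (\<bar>(x - y) / 2\<bar> * 1)"
      by (intro mult_left_mono mult_mono abs_sin_x_le_abs_x) auto
    finally show ?thesis by simp
  qed
  have c: "\<bar>cos x - cos y\<bar> \<le> \<bar>x - y\<bar>"
    using s[of "pi/2 - x" "pi/2 - y"] by (simp add: sin_diff cos_diff abs_minus_commute)
  let ?k = "curvature \<mu> (cos x) (sin x) t" and ?k' = "curvature \<mu> (cos y) (sin y) t"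
  have "\<bar>?k - ?k'\<bar> \<le> K * (\<bar>cos x - cos y\<bar> + \<bar>sin x - sin y\<bar>)"
    unfolding K_def by (rule curvature_lipschitz[OF t])
  also have "\<dots> \<le> K * (2 * \<bar>x - y\<bar>)"
    using s[of x y] c \<open>K > 0\<close> by (intro mult_left_mono) auto
  finally have kk: "\<bar>?k - ?k'\<bar> \<le> K * (2 * \<bar>x - y\<bar>)" .
  have "\<bar>?k'\<bar> \<le> K * (\<bar>cos y\<bar> + \<bar>sin y\<bar>)"
    using curvature_lipschitz[OF t, of \<mu> "cos y" "sin y" 0 0] curvature_zero[OF t] by (simp add: K_def)
  also have "\<dots> \<le> K * (1 + 1)"
    using \<open>K > 0\<close> by (intro mult_left_mono add_mono) auto
  finally have k': "\<bar>?k'\<bar> \<le> K * 2" by simp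
  have "\<bar>sin x * (?k - ?k')\<bar> \<le> 1 * (K * (2 * \<bar>x - y\<bar>))"
    unfolding abs_mult by (intro mult_mono kk) auto
  moreover have "\<bar>(sin x - sin y) * ?k'\<bar> \<le> \<bar>x - y\<bar> * (K * 2)"
    unfolding abs_mult by (intro mult_mono s k') auto
  moreover have "\<bar>(cos x - cos y) * (cos x + cos y)\<bar> \<le> \<bar>x - y\<bar> * (1 + 1)"
    unfolding abs_mult by (intro mult_mono c order_trans[OF abs_triangle_ineq] add_mono) auto
  moreover have "angular_speed \<mu> x t - angular_speed \<mu> y t =
      (cos x - cos y) * (cos x + cos y) - sin x * (?k - ?k') - (sin x - sin y) * ?k'"
    by (simp add: angular_speed_def power2_eq_square algebra_simps)
  ultimately show ?thesis unfolding K_def[symmetric] by (simp add: algebra_simps)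
qed

text \<open>The bounds of \<open>curvature_parameter\<close> on the unit circle. The lower one
  degenerates where \<open>sin x = 0\<close>, so strict monotonicity of the final angle takes a
  further argument.\<close>

lemma angular_speed_parameter:
  assumes t: "t \<in> {a..b}" and "\<mu> \<le> \<nu>"
  shows "(\<nu> - \<mu>) * (sin x)\<^sup>2 / \<Lambda> \<le> angular_speed \<nu> x t - angular_speed \<mu> x t"
    and "angular_speed \<nu> x t - angular_speed \<mu> x t \<le> (\<nu> - \<mu>) / l"
proof -
  have eq: "angular_speed \<nu> x t - angular_speed \<mu> x t
      = sin x * (curvature \<mu> (cos x) (sin x) t - curvature \<nu> (cos x) (sin x) t)"
    by (simp add: angular_speed_def algebra_simps)
  show "(\<nu> - \<mu>) * (sin x)\<^sup>2 / \<Lambda> \<le> angular_speed \<nu> x t - angular_speed \<mu> x t"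
    unfolding eq using curvature_parameter(1)[OF assms, of "sin x" "cos x"] Lambda_pos
    by (simp add: field_simps)
  have "(\<nu> - \<mu>) * (sin x)\<^sup>2 \<le> (\<nu> - \<mu>) * 1"
    using \<open>\<mu> \<le> \<nu>\<close> by (intro mult_left_mono) (auto simp: abs_square_le_1)
  then show "angular_speed \<nu> x t - angular_speed \<mu> x t \<le> (\<nu> - \<mu>) / l"
    unfolding eq using curvature_parameter(2)[OF assms, of "sin x" "cos x"] constants
    by (simp add: field_simps)
qed

text \<open>At parameter 0 the curvature is at most \<gamma>|cos x| + \<delta>|sin x|, divided by
  \<open>l\<close>. Young's inequality charges the mixed term to half of the squared cosine and a
  multiple of the squared sine; a large parameter outweighs the latter.\<close>

lemma angular_speed_ge:
  assumes t: "t \<in> {a..b}" and \<mu>: "\<mu> \<ge> \<Lambda> * (k\<^sup>2 / 2 + \<delta> / l + (\<gamma> / l)\<^sup>2 / 2)"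
  shows "((cos x)\<^sup>2 + k\<^sup>2 * (sin x)\<^sup>2) / 2 \<le> angular_speed \<mu> x t"
proof -
  define c s where "c = \<bar>cos x\<bar>" and "s = \<bar>sin x\<bar>"
  define g where "g = curvature 0 (cos x) (sin x) t"
  \<comment> \<open>The three terms provide the desired gain, the zeroth-order loss and the Young
    remainder, in this order.\<close>
  define C where "C = k\<^sup>2 / 2 + \<delta> / l + (\<gamma> / l)\<^sup>2 / 2"
  have "C \<ge> 0" "\<Lambda> * C \<le> \<mu>" using constants \<mu> by (auto simp: C_def)
  then have "\<mu> \<ge> 0" using Lambda_pos by (meson mult_nonneg_nonneg less_imp_le order_trans)
  have "C \<le> \<mu> / \<Lambda>" using \<open>\<Lambda> * C \<le> \<mu>\<close> Lambda_pos by (simp add: field_simps)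
  have "\<bar>g\<bar> \<le> (\<gamma> * c + \<delta> * s) / l"
    using curvature_lipschitz_lower_order[OF t, of 0 "cos x" "sin x" 0 0] curvature_zero[OF t, of 0]
    by (simp add: g_def c_def s_def)
  then have "s * \<bar>g\<bar> \<le> s * ((\<gamma> * c + \<delta> * s) / l)" by (intro mult_left_mono) (auto simp: s_def)
  then have "sin x * g \<le> (\<gamma> / l) * s * c + \<delta> / l * s\<^sup>2"
    using abs_ge_self[of "sin x * g"]
    by (simp add: abs_mult s_def power2_eq_square add_divide_distrib algebra_simps)
  moreover have "\<gamma> / l * s * c \<le> ((\<gamma> / l)\<^sup>2 * s\<^sup>2 + c\<^sup>2) / 2"
    using sum_squares_bound[of "\<gamma> / l * s" c] unfolding power_mult_distrib by (simp add: mult_ac)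
  moreover have "C * s\<^sup>2 \<le> \<mu> / \<Lambda> * s\<^sup>2" using \<open>C \<le> \<mu> / \<Lambda>\<close> by (intro mult_right_mono) auto
  then have "C * s\<^sup>2 \<le> angular_speed \<mu> x t - angular_speed 0 x t"
    using angular_speed_parameter(1)[OF t \<open>\<mu> \<ge> 0\<close>, of x] by (simp add: s_def)
  moreover have "angular_speed 0 x t = c\<^sup>2 - sin x * g"
    by (simp add: angular_speed_def g_def c_def)
  moreover have "C * s\<^sup>2 = k\<^sup>2 * s\<^sup>2 / 2 + \<delta> / l * s\<^sup>2 + (\<gamma> / l)\<^sup>2 * s\<^sup>2 / 2"
    by (simp add: C_def algebra_simps)
  moreover have "(cos x)\<^sup>2 = c\<^sup>2" "(sin x)\<^sup>2 = s\<^sup>2" by (simp_all add: c_def s_def)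
  ultimately show ?thesis by (simp add: add_divide_distrib)
qed

section \<open>The initial value problem for the angle\<close>

text \<open>Even \<open>j\<close> starts with positive slope of \<open>u\<close>, odd
  \<open>j\<close> with negative slope. A choice is made because the equation says nothing about
  values outside \<open>{a..b}\<close>.\<close>

definition angle :: "nat \<Rightarrow> real \<Rightarrow> real \<Rightarrow> real" where
  "angle j \<mu> = (SOME \<theta>. \<theta> a = real j * pi \<and>
     (\<forall>t\<in>{a..b}. (\<theta> has_real_derivative angular_speed \<mu> (\<theta> t) t) (at t within {a..b})))"

lemma angle_init: "angle j \<mu> a = real j * pi"
  and angle_deriv: "t \<in> {a..b} \<Longrightarrow>
    (angle j \<mu> has_real_derivative angular_speed \<mu> (angle j \<mu> t) t) (at t within {a..b})"
proof -
  have "\<exists>\<theta>. \<theta> a = real j * pi \<and>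
     (\<forall>t\<in>{a..b}. (\<theta> has_real_derivative angular_speed \<mu> (\<theta> t) t) (at t within {a..b}))"
    by (rule picard_lindelof_global[OF less_imp_le[OF less] angular_speed_continuous
          angular_speed_lipschitz])
  from someI_ex[OF this]
  show "angle j \<mu> a = real j * pi"
    and "t \<in> {a..b} \<Longrightarrow>
      (angle j \<mu> has_real_derivative angular_speed \<mu> (angle j \<mu> t) t) (at t within {a..b})"
    unfolding angle_def by blast+
qed

lemma continuous_on_angle: "continuous_on {a..b} (angle j \<mu>)"
  using angle_deriv by (rule DERIV_continuous_on)

text \<open>The speed is 1 wherever \<open>sin\<close> vanishes, so the constant \<open>k * pi\<close> is a strict subsolution.\<close>

lemma angle_crosses_upwards:
  assumes s: "s \<in> {a..b}" and t: "t \<in> {a..b}" and "s < t" and "angle j \<mu> s \<ge> real k * pi"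
  shows "angle j \<mu> t > real k * pi"
proof -
  have ge: "angle j \<mu> x \<ge> real k * pi" if x: "x \<in> {s..t}" for x
  proof -
    have sub: "{s..t} \<subseteq> {a..b}" using s t by auto
    have "real k * pi - angle j \<mu> x \<le> 0 * (x - s) * exp ((2 + 4 * lipschitz_const \<mu>) * (x - s))"
    proof (rule ode_comparison[of s t "angular_speed \<mu>" _ "\<lambda>_. real k * pi" "\<lambda>_. 0"])
      show "\<bar>angular_speed \<mu> x y - angular_speed \<mu> x' y\<bar> \<le> (2 + 4 * lipschitz_const \<mu>) * \<bar>x - x'\<bar>"
        if "y \<in> {s..t}" for x x' y
        using that sub by (intro angular_speed_lipschitz) auto
      show "(angle j \<mu> has_real_derivative angular_speed \<mu> (angle j \<mu> y) y) (at y within {s..t})"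
        if "y \<in> {s..t}" for y
        using that sub by (intro DERIV_subset[OF angle_deriv]) auto
    qed (use x assms in \<open>auto simp: angular_speed_sin_zero\<close>)
    then show ?thesis by simp
  qed
  show ?thesis
  proof (rule ccontr)
    assume "\<not> ?thesis"
    then have eq: "angle j \<mu> t = real k * pi" using ge[of t] \<open>s < t\<close> by simp
    \<comment> \<open>If the angle met the level at \<open>t\<close>, it would have slope 1 there
      and lie below the level just before.\<close>
    have "(angle j \<mu> has_real_derivative 1) (at t within {a..b})"
      using angle_deriv[OF t, of j \<mu>] by (simp add: eq angular_speed_sin_zero)
    then obtain d where d: "d > 0"
      "\<And>h. h > 0 \<Longrightarrow> t - h \<in> {a..b} \<Longrightarrow> h < d \<Longrightarrow> angle j \<mu> (t - h) < angle j \<mu> t"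
      using has_real_derivative_pos_inc_left[of "angle j \<mu>" 1 t "{a..b}"] by auto
    define h where "h = min (d / 2) (t - s)"
    have "h > 0" "h < d" "t - h \<in> {s..t}" using d(1) \<open>s < t\<close> by (auto simp: h_def)
    then have "angle j \<mu> (t - h) < real k * pi" using d(2)[of h] s t eq by auto
    with ge[OF \<open>t - h \<in> {s..t}\<close>] show False by simp
  qed
qed

section \<open>The final angle as a function of the parameter\<close>

text \<open>The speed is nondecreasing in the parameter, so the angle for \<open>\<nu>\<close> is a
  supersolution of the equation for \<open>\<mu>\<close>.\<close>

lemma angle_mono_parameter:
  assumes "\<mu> \<le> \<nu>" and t: "t \<in> {a..b}"
  shows "angle j \<mu> t \<le> angle j \<nu> t"
proof -
  have "angular_speed \<mu> x s \<le> angular_speed \<nu> x s" if "s \<in> {a..b}" for x s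
  proof -
    have "0 \<le> (\<nu> - \<mu>) * (sin x)\<^sup>2 / \<Lambda>" using \<open>\<mu> \<le> \<nu>\<close> Lambda_pos by simp
    then show ?thesis using angular_speed_parameter(1)[OF that \<open>\<mu> \<le> \<nu>\<close>, of x] by linarith
  qed
  then have "angle j \<mu> t - angle j \<nu> t \<le> 0 * (t - a) * exp ((2 + 4 * lipschitz_const \<mu>) * (t - a))"
    by (intro ode_comparison[OF angular_speed_lipschitz angle_deriv angle_deriv])
      (use t in \<open>auto simp: angle_init\<close>)
  then show ?thesis by simp
qed

text \<open>Equal final angles would force equal angles throughout, hence equal speeds, hence a
  vanishing sine on the whole open interval; but there the angle would move at speed 1.\<close>

lemma angle_end_strict_mono: "strict_mono (\<lambda>\<mu>. angle j \<mu> b)"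
proof (rule strict_monoI, rule ccontr)
  fix \<mu> \<nu> :: real
  assume "\<mu> < \<nu>" and "\<not> angle j \<mu> b < angle j \<nu> b"
  then have end_eq: "angle j \<mu> b = angle j \<nu> b"
    using angle_mono_parameter[of \<mu> \<nu> b j] less by auto
  define L where "L = 2 + 4 * lipschitz_const \<mu>"
  define w where "w t = angle j \<nu> t - angle j \<mu> t" for t
  define w' where "w' t = angular_speed \<nu> (angle j \<nu> t) t - angular_speed \<mu> (angle j \<mu> t) t" for t
  have w_deriv: "(w has_real_derivative w' t) (at t)" if "t \<in> {a<..<b}" for t
    using angle_deriv[of t j \<nu>] angle_deriv[of t j \<mu>] that at_within_Icc_at[of a t b]
    unfolding w_def w'_def by (auto intro!: DERIV_diff)
  have w_ge: "w t \<ge> 0" if "t \<in> {a..b}" for t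
    using angle_mono_parameter[of \<mu> \<nu> t j] that \<open>\<mu> < \<nu>\<close> by (simp add: w_def)
  have w'_ge: "w' t \<ge> - L * w t" if t: "t \<in> {a<..<b}" for t
  proof -
    have t': "t \<in> {a..b}" using t by simp
    have "0 \<le> (\<nu> - \<mu>) * (sin (angle j \<nu> t))\<^sup>2 / \<Lambda>" using \<open>\<mu> < \<nu>\<close> Lambda_pos by simp
    then have "angular_speed \<mu> (angle j \<nu> t) t \<le> angular_speed \<nu> (angle j \<nu> t) t"
      using angular_speed_parameter(1)[OF t' less_imp_le[OF \<open>\<mu> < \<nu>\<close>], of "angle j \<nu> t"] by linarith
    then show ?thesis
      using angular_speed_lipschitz[OF t', of \<mu> "angle j \<nu> t" "angle j \<mu> t", folded L_def] w_ge[OF t']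
      by (simp add: w_def w'_def abs_le_iff)
  qed
  have "w t = 0" if t: "t \<in> {a..b}" for t
  proof -
    \<comment> \<open>The integrating factor turns \<open>w' \<ge> - L * w\<close> into
      monotonicity, so \<open>w b = 0\<close> propagates backwards to the nonnegative
      \<open>w\<close>.\<close>
    have "w t * exp (L * t) \<le> w b * exp (L * b)"
    proof (rule DERIV_nonneg_imp_increasing_open[of t b "\<lambda>t. w t * exp (L * t)"])
      show "\<exists>y. ((\<lambda>t. w t * exp (L * t)) has_real_derivative y) (at s) \<and> 0 \<le> y"
        if "t < s" "s < b" for s
      proof (intro exI conjI)
        show "((\<lambda>t. w t * exp (L * t)) has_real_derivative (w' s + L * w s) * exp (L * s)) (at s)"
          using w_deriv[of s] that t by (auto intro!: derivative_eq_intros simp: algebra_simps)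
        show "0 \<le> (w' s + L * w s) * exp (L * s)"
          using w'_ge[of s] that t by simp
      qed
      show "continuous_on {t..b} (\<lambda>t. w t * exp (L * t))"
        unfolding w_def using t
        by (intro continuous_intros continuous_on_subset[OF continuous_on_angle]) auto
    qed (use t in simp)
    then show ?thesis using w_ge[OF t] end_eq by (simp add: w_def mult_le_0_iff)
  qed
  then have eq: "angle j \<mu> t = angle j \<nu> t" if "t \<in> {a..b}" for t using that by (simp add: w_def)
  have sin0: "sin (angle j \<mu> t) = 0" if t: "t \<in> {a<..<b}" for t
  proof -
    have t': "t \<in> {a..b}" using t by simp
    have "(w has_real_derivative 0) (at t)"
      by (rule has_field_derivative_transform_within_open[of "\<lambda>_. 0" _ _ "{a<..<b}"])
        (use t eq in \<open>auto simp: w_def\<close>)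
    then have "w' t = 0" using w_deriv[OF t] DERIV_unique by blast
    then have "(\<nu> - \<mu>) * (sin (angle j \<mu> t))\<^sup>2 / \<Lambda> \<le> 0"
      using angular_speed_parameter(1)[OF t' less_imp_le[OF \<open>\<mu> < \<nu>\<close>], of "angle j \<nu> t"] eq[OF t']
      by (simp add: w'_def)
    then show ?thesis using \<open>\<mu> < \<nu>\<close> Lambda_pos by (simp add: divide_le_0_iff mult_le_0_iff)
  qed
  define t where "t = (a + b) / 2"
  have t: "t \<in> {a<..<b}" using less by (simp add: t_def)
  have "(angle j \<mu> has_real_derivative 1) (at t)"
    using angle_deriv[of t j \<mu>] t sin0[OF t] at_within_Icc_at[of a t b]
    by (auto simp: angular_speed_sin_zero)
  then have "((\<lambda>t. sin (angle j \<mu> t)) has_real_derivative cos (angle j \<mu> t)) (at t)"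
    by (auto intro!: derivative_eq_intros)
  moreover have "((\<lambda>t. sin (angle j \<mu> t)) has_real_derivative 0) (at t)"
    by (rule has_field_derivative_transform_within_open[of "\<lambda>_. 0" _ _ "{a<..<b}"])
      (use t sin0 in auto)
  ultimately have "cos (angle j \<mu> t) = 0" using DERIV_unique by blast
  with sin0[OF t] show False using sin_cos_squared_add[of "angle j \<mu> t"] by simp
qed

text \<open>The angle for \<open>\<mu>\<close> is a supersolution of the equation for
  \<open>\<nu>\<close> up to the defect \<open>(\<nu> - \<mu>) / l\<close>. Bounding the parameters
  by \<open>R\<close> makes the exponential factor uniform.\<close>

lemma angle_end_continuous: "continuous_on {- R..R} (\<lambda>\<mu>. angle j \<mu> b)"
proof (rule lipschitz_on_continuous_on[OF lipschitz_on_leI])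
  define C where "C = (b - a) * exp ((2 + 4 * lipschitz_const R) * (b - a)) / l"
  show "C \<ge> 0" using less constants by (simp add: C_def)
  fix \<mu> \<nu> assume \<mu>\<nu>: "\<mu> \<in> {- R..R}" "\<nu> \<in> {- R..R}" "\<mu> \<le> \<nu>"
  have "angle j \<nu> b - angle j \<mu> b
      \<le> (\<nu> - \<mu>) / l * (b - a) * exp ((2 + 4 * lipschitz_const \<nu>) * (b - a))"
  proof (rule ode_comparison[OF angular_speed_lipschitz angle_deriv angle_deriv])
    fix t assume "t \<in> {a..b}"
    from angular_speed_parameter(2)[OF this \<open>\<mu> \<le> \<nu>\<close>, of "angle j \<mu> t"]
    show "angular_speed \<nu> (angle j \<mu> t) t \<le> angular_speed \<mu> (angle j \<mu> t) t + (\<nu> - \<mu>) / l"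
      by simp
  qed (use \<mu>\<nu> less constants in \<open>auto simp: angle_init\<close>)
  also have "\<dots> \<le> (\<nu> - \<mu>) / l * (b - a) * exp ((2 + 4 * lipschitz_const R) * (b - a))"
  proof -
    have "lipschitz_const \<nu> \<le> lipschitz_const R"
      using \<mu>\<nu> constants by (auto simp: lipschitz_const_def intro!: divide_right_mono)
    then show ?thesis
      using \<mu>\<nu> less constants by (intro mult_left_mono) auto
  qed
  also have "\<dots> = C * (\<nu> - \<mu>)" by (simp add: C_def)
  finally show "dist (angle j \<mu> b) (angle j \<nu> b) \<le> C * dist \<mu> \<nu>"
    using angle_mono_parameter[of \<mu> \<nu> b j] \<mu>\<nu> less by (simp add: dist_real_def)
qed

lemma angle_end_small: "\<exists>\<mu>. angle j \<mu> b \<le> real j * pi + pi / 2"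
proof
  \<comment> \<open>Where \<open>cos y = 0\<close>, the speed at parameter 0 is at most
    \<open>\<delta> / l\<close>; lowering the parameter to this value takes away at least as
    much.\<close>
  define \<mu> where "\<mu> = - (\<Lambda> * (\<delta> / l))"
  define y where "y = real j * pi + pi / 2"
  have "cos y = 0" by (simp add: y_def cos_add)
  then have sin_y: "(sin y)\<^sup>2 = 1" using sin_cos_squared_add[of y] by simp
  then have abs_sin: "\<bar>sin y\<bar> = 1" by (auto simp: power2_eq_1_iff)
  have speed: "angular_speed \<mu> y t \<le> 0" if t: "t \<in> {a..b}" for t
  proof -
    have "\<mu> \<le> 0" using Lambda_pos constants by (simp add: \<mu>_def)
    from angular_speed_parameter(1)[OF t this, of y]
    have "angular_speed \<mu> y t \<le> angular_speed 0 y t - \<delta> / l"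
      using Lambda_pos by (simp add: sin_y \<mu>_def)
    moreover have "\<bar>curvature 0 0 (sin y) t\<bar> \<le> \<delta> / l"
      using curvature_lipschitz_lower_order[OF t, of 0 0 "sin y" 0 0] curvature_zero[OF t, of 0]
      by (simp add: abs_sin)
    then have "\<bar>angular_speed 0 y t\<bar> \<le> \<delta> / l"
      by (simp add: angular_speed_def \<open>cos y = 0\<close> abs_mult abs_sin)
    ultimately show ?thesis by simp
  qed
  have "angle j \<mu> b - y \<le> 0 * (b - a) * exp ((2 + 4 * lipschitz_const \<mu>) * (b - a))"
    by (rule ode_comparison[OF angular_speed_lipschitz angle_deriv, where \<psi>' = "\<lambda>_. 0"])
      (use speed less in \<open>auto simp: angle_init y_def\<close>)
  then show "angle j \<mu> b \<le> real j * pi + pi / 2" by (simp add: y_def)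
qed

text \<open>Along the angle, \<open>scaled_angle k\<close> moves at speed at least
  \<open>k / 2\<close>, as the denominator of its derivative cancels against the bound of
  \<open>angular_speed_ge\<close>. It stays within \<pi>/2 of the angle itself.\<close>

lemma angle_end_large: "\<exists>\<mu>. M \<le> angle j \<mu> b"
proof
  \<comment> \<open>Chosen so that \<open>k / 2 * (b - a)\<close> reaches \<open>M\<close> plus the
    \<pi>/2 lost in passing back to the angle.\<close>
  define k where "k = max 1 (2 * (M + pi / 2) / (b - a))"
  define \<mu> where "\<mu> = \<Lambda> * (k\<^sup>2 / 2 + \<delta> / l + (\<gamma> / l)\<^sup>2 / 2)"
  define \<theta> where "\<theta> = angle j \<mu>"
  have "k > 0" by (simp add: k_def)
  have "2 * (M + pi / 2) / (b - a) \<le> k" by (simp add: k_def)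
  then have k: "M + pi / 2 \<le> k / 2 * (b - a)" using less by (simp add: field_simps)
  define \<beta> where "\<beta> t = scaled_angle k (\<theta> t) - k / 2 * (t - a)" for t
  have scaled_cont: "continuous_on UNIV (scaled_angle k)"
    by (rule DERIV_continuous_on, rule DERIV_subset, rule scaled_angle_deriv[OF \<open>k > 0\<close>]) simp
  have "\<beta> a \<le> \<beta> b"
  proof (rule DERIV_nonneg_imp_increasing_open[of a b \<beta>])
    fix t assume "a < t" "t < b"
    define D where "D = (cos (\<theta> t))\<^sup>2 + k\<^sup>2 * (sin (\<theta> t))\<^sup>2"
    have "D > 0" unfolding D_def using \<open>k > 0\<close> by (intro sin_cos_form_pos) simp
    have "(\<theta> has_real_derivative angular_speed \<mu> (\<theta> t) t) (at t)"
      using angle_deriv[of t j \<mu>] at_within_Icc_at[of a t b] \<open>a < t\<close> \<open>t < b\<close> by (simp add: \<theta>_def)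
    from DERIV_chain2[OF scaled_angle_deriv[OF \<open>k > 0\<close>] this]
    have "(\<beta> has_real_derivative k / D * angular_speed \<mu> (\<theta> t) t - k / 2) (at t)"
      unfolding \<beta>_def D_def by (auto intro!: derivative_eq_intros)
    moreover have "k / D * angular_speed \<mu> (\<theta> t) t \<ge> k / D * (D / 2)"
      using \<open>k > 0\<close> \<open>D > 0\<close> \<open>a < t\<close> \<open>t < b\<close>
      by (intro mult_left_mono angular_speed_ge[of t k \<mu> "\<theta> t", folded D_def]) (auto simp: \<mu>_def)
    ultimately show "\<exists>y. (\<beta> has_real_derivative y) (at t) \<and> 0 \<le> y"
      using \<open>D > 0\<close> by (intro exI conjI) auto
  next
    show "continuous_on {a..b} \<beta>"
      unfolding \<beta>_def \<theta>_def
      by (intro continuous_intros continuous_on_angle continuous_on_compose2[OF scaled_cont]) auto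
  qed (use less in simp)
  moreover have "\<beta> a = real j * pi" by (simp add: \<beta>_def \<theta>_def angle_init scaled_angle_def)
  moreover have "\<beta> b \<le> \<theta> b + pi / 2 - k / 2 * (b - a)"
    using arctan_ubound by (simp add: \<beta>_def scaled_angle_def less_imp_le)
  moreover have "0 \<le> real j * pi" by simp
  ultimately show "M \<le> angle j \<mu> b" using k unfolding \<theta>_def by linarith
qed

lemma angle_end_gt: "real j * pi < angle j \<mu> b"
  using angle_crosses_upwards[of a b j j \<mu>] less by (simp add: angle_init)

lemma angle_end_attains:
  assumes "real j * pi + pi / 2 \<le> y"
  shows "\<exists>\<mu>. angle j \<mu> b = y"
proof -
  obtain \<mu> where \<mu>: "angle j \<mu> b \<le> y"
    using angle_end_small[of j] assms by (meson order_trans)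
  obtain \<nu> where \<nu>: "y \<le> angle j \<nu> b" using angle_end_large by blast
  have "\<mu> \<le> \<nu>"
  proof (rule ccontr)
    assume "\<not> \<mu> \<le> \<nu>"
    then show False using strict_monoD[OF angle_end_strict_mono, of \<nu> \<mu> j] \<mu> \<nu> by simp
  qed
  define R where "R = max \<bar>\<mu>\<bar> \<bar>\<nu>\<bar>"
  have "continuous_on {\<mu>..\<nu>} (\<lambda>\<mu>. angle j \<mu> b)"
    by (rule continuous_on_subset[OF angle_end_continuous[of R]]) (auto simp: R_def)
  from IVT'[OF \<mu> \<nu> \<open>\<mu> \<le> \<nu>\<close> this] show ?thesis by blast
qed

text \<open>The final angle exceeds its start \<open>real j * pi\<close>, so the multiples of \<pi>
  it can take are those with factor \<open>j + n + 1\<close>; each is attained, and strict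
  monotonicity makes the parameter unique and increasing in \<open>n\<close>.\<close>

lemma eigenvalue_sequence:
  obtains ev :: "nat \<Rightarrow> real" where "strict_mono ev"
    and "\<And>n. angle j (ev n) b = real (j + n + 1) * pi"
    and "\<And>\<mu>. sin (angle j \<mu> b) = 0 \<Longrightarrow> \<exists>n. \<mu> = ev n"
proof -
  have "\<exists>\<mu>. angle j \<mu> b = real (j + n + 1) * pi" for n
  proof (rule angle_end_attains)
    have "real n * pi \<ge> 0" by simp
    then show "real j * pi + pi / 2 \<le> real (j + n + 1) * pi"
      using pi_gt_zero by (simp add: algebra_simps)
  qed
  then obtain ev where ev: "\<And>n. angle j (ev n) b = real (j + n + 1) * pi" by metis
  show thesis
  proof (rule that[OF _ ev])
    show "strict_mono ev"
    proof (rule strict_monoI)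
      fix m n :: nat assume "m < n"
      then have "angle j (ev m) b < angle j (ev n) b" unfolding ev by simp
      then show "ev m < ev n" using strict_mono_less[OF angle_end_strict_mono] by blast
    qed
    fix \<mu> assume "sin (angle j \<mu> b) = 0"
    then obtain i :: int where i: "angle j \<mu> b = of_int i * pi" by (auto simp: sin_zero_iff_int2)
    then have "real j < of_int i"
      using angle_end_gt[of j \<mu>] by (simp add: mult_less_cancel_right)
    then obtain n where "i = int (j + n + 1)"
      by (metis of_int_of_nat_eq of_int_less_iff zless_iff_Suc_zadd int_ops(4) add.assoc Suc_eq_plus1 of_nat_add)
    then have "angle j \<mu> b = angle j (ev n) b" using i ev[of n] by simp
    then show "\<exists>n. \<mu> = ev n" using strict_mono_eq[OF angle_end_strict_mono] by blast
  qed
qed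

section \<open>Trajectories of the second-order equation\<close>

text \<open>The first-order system for \<open>u\<close> and its slope \<open>v\<close>. Asking only
  for continuity at the endpoints admits solutions whose second derivative is known only inside the
  interval.\<close>

definition trajectory :: "real \<Rightarrow> (real \<Rightarrow> real) \<Rightarrow> (real \<Rightarrow> real) \<Rightarrow> bool" where
  "trajectory \<mu> u v \<longleftrightarrow> continuous_on {a..b} u \<and> continuous_on {a..b} v \<and>
     (\<forall>t\<in>{a<..<b}. (u has_real_derivative v t) (at t) \<and>
        (v has_real_derivative curvature \<mu> (v t) (u t) t) (at t))"

text \<open>Gronwall for the squared distance \<open>E\<close> in the phase plane, whose derivative
  is at most \<open>(1 + 3 * K) * E t\<close> by the Lipschitz bound for the curvature.\<close>

lemma trajectory_unique:
  assumes "trajectory \<mu> u v" "trajectory \<mu> x y" "u a = x a" "v a = y a" and s: "s \<in> {a..b}"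
  shows "u s = x s"
proof -
  define K where "K = lipschitz_const \<mu>"
  have "K > 0" by (simp add: K_def lipschitz_const_pos)
  define E where "E t = (u t - x t)\<^sup>2 + (v t - y t)\<^sup>2" for t
  define E' where "E' t = 2 * ((u t - x t) * (v t - y t)
    + (v t - y t) * (curvature \<mu> (v t) (u t) t - curvature \<mu> (y t) (x t) t))" for t
  have "E s \<le> 0 * (s - a) * exp ((1 + 3 * K) * (s - a))"
  proof (rule gronwall_where_pos[of a b E E'])
    show "continuous_on {a..b} E"
      using assms unfolding E_def trajectory_def by (intro continuous_intros) auto
    show "E a \<le> 0" using assms by (simp add: E_def)
    fix t assume t: "t \<in> {a<..<b}"
    have d: "(u has_real_derivative v t) (at t)" "(x has_real_derivative y t) (at t)"
        "(v has_real_derivative curvature \<mu> (v t) (u t) t) (at t)"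
        "(y has_real_derivative curvature \<mu> (y t) (x t) t) (at t)"
      using assms t by (auto simp: trajectory_def)
    show "(E has_real_derivative E' t) (at t)"
      unfolding E_def E'_def
      by (auto intro!: derivative_eq_intros d simp: algebra_simps)
    define p q c where "p = \<bar>u t - x t\<bar>" and "q = \<bar>v t - y t\<bar>"
      and "c = curvature \<mu> (v t) (u t) t - curvature \<mu> (y t) (x t) t"
    have "\<bar>c\<bar> \<le> K * (q + p)"
      unfolding c_def K_def p_def q_def by (rule curvature_lipschitz) (use t in simp)
    then have "q * \<bar>c\<bar> \<le> q * (K * (q + p))" by (intro mult_left_mono) (auto simp: q_def)
    moreover have "(u t - x t) * (v t - y t) \<le> p * q" "(v t - y t) * c \<le> q * \<bar>c\<bar>"
      unfolding p_def q_def by (metis abs_ge_self abs_mult)+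
    ultimately have "E' t \<le> 2 * p * q * (1 + K) + 2 * K * q\<^sup>2"
      by (simp add: E'_def c_def power2_eq_square algebra_simps)
    also have "\<dots> \<le> (p\<^sup>2 + q\<^sup>2) * (1 + K) + 2 * K * (p\<^sup>2 + q\<^sup>2)"
      using \<open>K > 0\<close> sum_squares_bound[of p q] by (intro add_mono mult_right_mono mult_left_mono) auto
    also have "\<dots> = (1 + 3 * K) * E t + 0" by (simp add: E_def p_def q_def algebra_simps)
    finally show "E' t \<le> (1 + 3 * K) * E t + 0" .
  qed (use s \<open>K > 0\<close> in auto)
  then show ?thesis by (simp add: E_def sum_power2_le_zero_iff)
qed

lemma trajectory_scale:
  assumes "trajectory \<mu> u v" "c \<ge> 0"
  shows "trajectory \<mu> (\<lambda>t. c * u t) (\<lambda>t. c * v t)"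
proof -
  have "curvature \<mu> (c * v t) (c * u t) t = c * curvature \<mu> (v t) (u t) t" if "t \<in> {a<..<b}" for t
    using that assms(2) by (intro curvature_homogeneous) auto
  then show ?thesis
    using assms unfolding trajectory_def by (auto intro!: continuous_intros DERIV_cmult)
qed

text \<open>The one-sided derivative on the closed interval serves as \<open>v\<close>; inside it
  agrees with \<open>deriv u\<close>, and uniqueness of the root identifies
  \<open>deriv (deriv u)\<close> with the curvature.\<close>

lemma trajectory_if_solution:
  assumes "is_solution a b F \<mu> u"
  obtains v where "trajectory \<mu> u v"
proof -
  from assms obtain v
    where v: "\<And>t. t \<in> {a..b} \<Longrightarrow> (u has_real_derivative v t) (at t within {a..b})"
      and cont_v: "continuous_on {a..b} v"
    unfolding is_solution_def C1_closed_def by blast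
  have u_deriv: "(u has_real_derivative v t) (at t)" if "t \<in> {a<..<b}" for t
    using v[of t] that at_within_Icc_at[of a t b] by simp
  then have deriv_u: "deriv u t = v t" if "t \<in> {a<..<b}" for t
    using that by (intro DERIV_imp_deriv)
  have "(v has_real_derivative curvature \<mu> (v t) (u t) t) (at t)" if t: "t \<in> {a<..<b}" for t
  proof -
    have "deriv u differentiable at t"
      using assms t differentiable_on_eq_differentiable_at[of "{a<..<b}" "deriv u"]
      by (auto simp: is_solution_def C2_open_def)
    then have "(deriv u has_real_derivative deriv (deriv u) t) (at t)"
      by (simp add: DERIV_deriv_iff_real_differentiable)
    then have "(v has_real_derivative deriv (deriv u) t) (at t)"
      by (rule has_field_derivative_transform_within_open[of _ _ _ "{a<..<b}"]) (use t deriv_u in auto)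
    moreover have "F (deriv (deriv u) t) (v t) (u t) t = - \<mu> * u t"
      using assms t unfolding deriv_u[OF t, symmetric] by (auto simp: is_solution_def)
    then have "curvature \<mu> (v t) (u t) t = deriv (deriv u) t"
      using t by (intro curvature_unique) auto
    ultimately show ?thesis by simp
  qed
  then have "trajectory \<mu> u v"
    using u_deriv cont_v DERIV_continuous_on[OF v] by (auto simp: trajectory_def)
  then show thesis by (rule that)
qed

lemma solution_if_trajectory:
  assumes traj: "trajectory \<mu> u v"
    and u_deriv: "\<And>t. t \<in> {a..b} \<Longrightarrow> (u has_real_derivative v t) (at t within {a..b})"
    and bc: "u a = 0" "u b = 0"
  shows "is_solution a b F \<mu> u"
proof -
  let ?I = "{a<..<b}"
  have d: "(u has_real_derivative v t) (at t)" "(v has_real_derivative curvature \<mu> (v t) (u t) t) (at t)"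
    if "t \<in> ?I" for t
    using traj that by (auto simp: trajectory_def)
  have deriv_u: "deriv u t = v t" if "t \<in> ?I" for t
    using d(1)[OF that] by (rule DERIV_imp_deriv)
  have d2: "(deriv u has_real_derivative curvature \<mu> (v t) (u t) t) (at t)" if "t \<in> ?I" for t
    by (rule has_field_derivative_transform_within_open[OF d(2), of t ?I]) (use that deriv_u in auto)
  have deriv2_u: "deriv (deriv u) t = curvature \<mu> (v t) (u t) t" if "t \<in> ?I" for t
    using d2[OF that] by (rule DERIV_imp_deriv)
  have cont: "continuous_on {a..b} u" "continuous_on {a..b} v"
    using traj by (auto simp: trajectory_def)
  have "continuous_on ?I (\<lambda>t. curvature \<mu> (v t) (u t) t)"
    using cont by (intro continuous_on_curvature continuous_on_id)
      (auto intro: continuous_on_subset)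
  then have "continuous_on ?I (deriv (deriv u))"
    by (subst continuous_on_cong[OF refl deriv2_u])
  moreover have "u differentiable_on ?I" "deriv u differentiable_on ?I"
    using d(1) d2 differentiable_at_imp_differentiable_on real_differentiable_def by blast+
  ultimately have "C2_open a b u" by (simp add: C2_open_def)
  moreover have "C1_closed a b u" using u_deriv cont unfolding C1_closed_def by blast
  moreover have "F (deriv (deriv u) t) (deriv u t) (u t) t = - \<mu> * u t" if "t \<in> ?I" for t
    using that by (simp add: deriv_u deriv2_u F_curvature)
  ultimately show ?thesis using bc by (simp add: is_solution_def)
qed

section \<open>Recovering solutions from the angle\<close>

text \<open>The polar radius \<open>r\<close> with \<open>r a = 1\<close>: its logarithmic
  derivative is cos \<theta> times the sum of sin \<theta> and the curvature at (cos \<theta>, sin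
  \<theta>).\<close>

definition amplitude :: "nat \<Rightarrow> real \<Rightarrow> real \<Rightarrow> real" where
  "amplitude j \<mu> t = exp (integral {a..t} (\<lambda>s. cos (angle j \<mu> s) *
     (sin (angle j \<mu> s) + curvature \<mu> (cos (angle j \<mu> s)) (sin (angle j \<mu> s)) s)))"

text \<open>The trajectory shot from \<open>a\<close> with value 0 and slope
  \<open>(- 1) ^ j\<close>.\<close>

definition shot :: "nat \<Rightarrow> real \<Rightarrow> real \<Rightarrow> real" where
  "shot j \<mu> t = amplitude j \<mu> t * sin (angle j \<mu> t)"

definition shot_slope :: "nat \<Rightarrow> real \<Rightarrow> real \<Rightarrow> real" where
  "shot_slope j \<mu> t = amplitude j \<mu> t * cos (angle j \<mu> t)"

lemma amplitude_pos: "amplitude j \<mu> t > 0"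
  by (simp add: amplitude_def)

lemma shot_deriv:
  assumes t: "t \<in> {a..b}"
  shows "(shot j \<mu> has_real_derivative shot_slope j \<mu> t) (at t within {a..b})"
    and "(shot_slope j \<mu> has_real_derivative curvature \<mu> (shot_slope j \<mu> t) (shot j \<mu> t) t)
           (at t within {a..b})"
proof -
  define \<theta> where "\<theta> = angle j \<mu>"
  define s c where "s = sin (\<theta> t)" and "c = cos (\<theta> t)"
  have sc: "s * s + c * c = 1"
    using sin_cos_squared_add[of "\<theta> t"] by (simp add: s_def c_def power2_eq_square)
  define k where "k = curvature \<mu> c s t"
  have \<theta>: "(\<theta> has_real_derivative c * c - s * k) (at t within {a..b})"
    using angle_deriv[OF t, of j \<mu>]
    by (simp add: \<theta>_def s_def c_def k_def angular_speed_def power2_eq_square)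
  have r: "(amplitude j \<mu> has_real_derivative amplitude j \<mu> t * (c * (s + k))) (at t within {a..b})"
    unfolding amplitude_def[abs_def]
    by (rule DERIV_chain2[OF DERIV_exp, THEN DERIV_cong], rule integral_has_real_derivative[OF _ t])
      (auto intro!: continuous_intros continuous_on_angle continuous_on_curvature
        simp: s_def c_def k_def \<theta>_def)
  \<comment> \<open>Positive homogeneity pulls the radius out of the curvature; the rest is algebra
    with \<open>s * s + c * c = 1\<close>.\<close>
  have k_eq: "curvature \<mu> (amplitude j \<mu> t * c) (amplitude j \<mu> t * s) t = amplitude j \<mu> t * k"
    unfolding k_def using amplitude_pos by (intro curvature_homogeneous[OF t] less_imp_le)
  define A where "A = amplitude j \<mu> t"
  have "(shot j \<mu> has_real_derivative
      A * (c * (s + k)) * s + A * (c * (c * c - s * k))) (at t within {a..b})"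
    unfolding shot_def[abs_def] \<theta>_def[symmetric]
    by (auto intro!: derivative_eq_intros r \<theta> simp: s_def c_def A_def)
  moreover have "A * (c * (s + k)) * s + A * (c * (c * c - s * k)) = A * c"
    using sc by algebra
  ultimately show "(shot j \<mu> has_real_derivative shot_slope j \<mu> t) (at t within {a..b})"
    by (simp only: shot_slope_def A_def c_def \<theta>_def)
  have "(shot_slope j \<mu> has_real_derivative
      A * (c * (s + k)) * c - A * (s * (c * c - s * k))) (at t within {a..b})"
    unfolding shot_slope_def[abs_def] \<theta>_def[symmetric]
    by (auto intro!: derivative_eq_intros r \<theta> simp: s_def c_def A_def)
  moreover have "A * (c * (s + k)) * c - A * (s * (c * c - s * k)) = A * k"
    using sc by algebra
  ultimately show "(shot_slope j \<mu> has_real_derivative curvature \<mu> (shot_slope j \<mu> t) (shot j \<mu> t) t)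
           (at t within {a..b})"
    using k_eq by (simp only: shot_slope_def shot_def A_def c_def s_def \<theta>_def)
qed

lemma shot_trajectory: "trajectory \<mu> (shot j \<mu>) (shot_slope j \<mu>)"
  unfolding trajectory_def
proof (intro conjI ballI)
  show "continuous_on {a..b} (shot j \<mu>)" "continuous_on {a..b} (shot_slope j \<mu>)"
    by (rule DERIV_continuous_on, erule shot_deriv)+
  fix t assume "t \<in> {a<..<b}"
  then show "(shot j \<mu> has_real_derivative shot_slope j \<mu> t) (at t)"
    "(shot_slope j \<mu> has_real_derivative curvature \<mu> (shot_slope j \<mu> t) (shot j \<mu> t) t) (at t)"
    using shot_deriv[of t j \<mu>] at_within_Icc_at[of a t b] by auto
qed

lemma shot_init: "shot j \<mu> a = 0" "shot_slope j \<mu> a = (- 1) ^ j"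
  by (simp_all add: shot_def shot_slope_def amplitude_def angle_init cos_npi)

lemma shot_solution:
  assumes "sin (angle j \<mu> b) = 0"
  shows "is_solution a b F \<mu> (shot j \<mu>)"
  using shot_trajectory shot_deriv(1) shot_init(1) assms
  by (intro solution_if_trajectory) (auto simp: shot_def)

text \<open>Subtracting \<open>real j * pi\<close> makes the angle start at 0 and multiplies its
  sine by \<open>(- 1) ^ j\<close>.\<close>

lemma shot_nodal:
  assumes "angle j \<mu> b = real (j + n + 1) * pi"
  shows "nodal a b n (\<lambda>t. (- 1) ^ j * shot j \<mu> t)"
proof (rule nodal_if_polar[of a b "\<lambda>t. angle j \<mu> t - real j * pi" _ "amplitude j \<mu>"])
  fix k :: nat and s t
  assume *: "s \<in> {a..b}" "t \<in> {a..b}" "s < t" "real k * pi \<le> angle j \<mu> s - real j * pi"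
  then show "real k * pi < angle j \<mu> t - real j * pi"
    using angle_crosses_upwards[of s t "k + j" j \<mu>] by (simp add: algebra_simps)
qed (use less assms in \<open>auto intro!: continuous_intros continuous_on_angle
      simp: angle_init amplitude_pos shot_def sin_diff cos_npi algebra_simps\<close>)

text \<open>Since \<open>u a = 0\<close>, the initial slope determines \<open>u\<close>. Its sign
  selects the shot and its modulus is the factor; homogeneity holds for nonnegative factors, whence
  the two families. A zero slope would give \<open>u = 0\<close>.\<close>

lemma eigenfunction_is_shot:
  assumes "is_eigenpair a b F \<mu> u"
  obtains j c where "j \<in> {0, 1}" "c > 0" "\<And>t. t \<in> {a..b} \<Longrightarrow> u t = c * shot j \<mu> t"
proof -
  from assms have sol: "is_solution a b F \<mu> u" and nontrivial: "\<exists>t\<in>{a..b}. u t \<noteq> 0"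
    by (auto simp: is_eigenpair_def)
  from sol have "u a = 0" by (simp add: is_solution_def)
  obtain v where v: "trajectory \<mu> u v" using trajectory_if_solution[OF sol] .
  define j :: nat where "j = (if v a \<ge> 0 then 0 else 1)"
  have eq: "u t = \<bar>v a\<bar> * shot j \<mu> t" if "t \<in> {a..b}" for t
    by (rule trajectory_unique[OF v trajectory_scale[OF shot_trajectory[of \<mu> j], of "\<bar>v a\<bar>"] _ _ that])
      (simp_all add: \<open>u a = 0\<close> shot_init j_def)
  moreover have "v a \<noteq> 0" using nontrivial eq by auto
  ultimately show thesis by (intro that[of j "\<bar>v a\<bar>"]) (auto simp: j_def)
qed

end

section \<open>The two sequences of eigenpairs and their completeness\<close>

theorem theorem4p1:
  fixes a b :: real
    and F :: "real \<Rightarrow> real \<Rightarrow> real \<Rightarrow> real \<Rightarrow> real"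
  assumes "a < b"
    and "continuous_operator a b F"
    and "F1 a b F" and "F2 a b F" and "F3 a b F"
  shows "\<exists>(lp :: nat \<Rightarrow> real) (up :: nat \<Rightarrow> real \<Rightarrow> real)
            (lm :: nat \<Rightarrow> real) (um :: nat \<Rightarrow> real \<Rightarrow> real).
      (\<forall>n. is_solution a b F (lp n) (up n) \<and> nodal a b n (up n)) \<and>
      (\<forall>n. is_solution a b F (lm n) (um n) \<and> nodal a b n (\<lambda>t. - um n t)) \<and>
      strict_mono lp \<and> strict_mono lm \<and>
      (\<forall>\<mu> u. is_eigenpair a b F \<mu> u \<longrightarrow>
         (\<exists>n. \<exists>c>0. (\<mu> = lp n \<and> (\<forall>t\<in>{a..b}. u t = c * up n t)) \<or>
                    (\<mu> = lm n \<and> (\<forall>t\<in>{a..b}. u t = c * um n t))))"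
proof -
  from \<open>F2 a b F\<close> obtain \<Lambda> l \<gamma> \<delta> where "l \<le> \<Lambda>" "0 < l" "0 < \<gamma>" "0 < \<delta>"
    and "\<forall>m p u m' p' u'. \<forall>t\<in>{a..b}.
      l * pos_part (m - m') - \<Lambda> * neg_part (m - m') - \<gamma> * \<bar>p - p'\<bar> - \<delta> * \<bar>u - u'\<bar>
        \<le> F m p u t - F m' p' u' t \<and>
      F m p u t - F m' p' u' t
        \<le> \<Lambda> * pos_part (m - m') - l * neg_part (m - m') + \<gamma> * \<bar>p - p'\<bar> + \<delta> * \<bar>u - u'\<bar>"
    unfolding F2_def by blast
  with assms(1-3) interpret uniformly_elliptic_operator a b F l \<Lambda> \<gamma> \<delta>
    by unfold_locales blast+
  obtain lp where lp: "strict_mono lp" "\<And>n. angle 0 (lp n) b = real (0 + n + 1) * pi"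
    "\<And>\<mu>. sin (angle 0 \<mu> b) = 0 \<Longrightarrow> \<exists>n. \<mu> = lp n"
    by (rule eigenvalue_sequence[of 0]) blast
  obtain lm where lm: "strict_mono lm" "\<And>n. angle 1 (lm n) b = real (1 + n + 1) * pi"
    "\<And>\<mu>. sin (angle 1 \<mu> b) = 0 \<Longrightarrow> \<exists>n. \<mu> = lm n"
    by (rule eigenvalue_sequence[of 1]) blast
  have "is_solution a b F (lp n) (shot 0 (lp n))" "is_solution a b F (lm n) (shot 1 (lm n))" for n
    by (intro shot_solution, simp only: lp lm sin_npi)+
  moreover have "nodal a b n (shot 0 (lp n))" "nodal a b n (\<lambda>t. - shot 1 (lm n) t)" for n
    using shot_nodal[OF lp(2)[of n]] shot_nodal[OF lm(2)[of n]] by simp_all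
  moreover have "\<exists>n. \<exists>c>0. (\<mu> = lp n \<and> (\<forall>t\<in>{a..b}. u t = c * shot 0 (lp n) t)) \<or>
      (\<mu> = lm n \<and> (\<forall>t\<in>{a..b}. u t = c * shot 1 (lm n) t))" if eig: "is_eigenpair a b F \<mu> u" for \<mu> u
  proof -
    obtain j c where jc: "j \<in> {0, 1}" "c > 0" and u: "\<And>t. t \<in> {a..b} \<Longrightarrow> u t = c * shot j \<mu> t"
      using eigenfunction_is_shot[OF eig] by metis
    have "u b = 0" using eig by (simp add: is_eigenpair_def is_solution_def)
    \<comment> \<open>The radius is positive, so the boundary condition at \<open>b\<close> concerns
      the angle alone and places \<open>\<mu>\<close> in the sequence belonging to
      \<open>j\<close>.\<close>
    then have "sin (angle j \<mu> b) = 0"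
      using u[of b] \<open>a < b\<close> \<open>c > 0\<close> amplitude_pos[of j \<mu> b] by (simp add: shot_def)
    with jc(1) lp(3)[of \<mu>] lm(3)[of \<mu>]
    consider n where "j = 0" "\<mu> = lp n" | n where "j = 1" "\<mu> = lm n" by auto
    then show ?thesis by cases (use u \<open>c > 0\<close> in blast)+
  qed
  ultimately show ?thesis
    using lp(1) lm(1)
    by (intro exI[of _ lp] exI[of _ "\<lambda>n. shot 0 (lp n)"] exI[of _ lm] exI[of _ "\<lambda>n. shot 1 (lm n)"]) auto
qed

end
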